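(* Let $\psi$ be an analytic wavelet in $L^1(\mathbb{R})\cap L^2(\mathbb{R})$ whose Fourier transform $\widehat\psi$ is Lipschitz continuous on $[0,\infty)$ with Lipschitz constant $\|\widehat\psi\|_{\mathrm{Lip}}$, and let $\Phi$ satisfy the noise conditions (i), (ii) and (iii) of the context. Then $$\mathbb{E}\Big[\sup_{s>0}|W_\Phi(0,s)|\Big]\le4\left[\sqrt{\ln\mathcal{D}}\,\frac{\mathcal{D}^3}{(\mathcal{D}-1)^2}\sqrt{\frac1\gamma+\frac1{H^-}}+\left(\sqrt{\frac1\gamma\ln C_2}+\sqrt{\ln T}\right)\frac{\mathcal{D}^2}{\mathcal{D}-1}\right],$$ where $$\mathcal{D}=2\vee\Big\{\sup_{s>0}\mathbb{E}\left[|W_\Phi(0,s)|^2\right]\Big\}^{1/2},$$ $$C_2=1\vee\left[C_1\left(\frac1\gamma+\frac2{2-\gamma}\right)(2\|\widehat\psi\|_\infty)^{2-\gamma}\|\widehat\psi\|_{\mathrm{Lip}}^{\gamma}+2\|\widehat\psi\|_\infty^2\,\mathrm{Var}(\Phi(0))\right]^{1/2},$$ $H^-$ is any constant in $(0,H)$ in the long-range dependence case and $H^-=1$ in the short-range dependence case, and $T\ge1$ is a threshold such that $\mathbb{E}[|W_\Phi(0,s)|^2]\le s^{-H^-}$ for all $s\ge T$.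
   Context: **Noise conditions.** (i) $\Phi=\{\Phi(t)\}_{t\in\mathbb{R}}$ is a real-valued, mean-square continuous, stationary Gaussian process whose covariance has a spectral density $p:\mathbb{R}\to(0,\infty)$, i.e. $\mathrm{Cov}(\Phi(t),\Phi(0))=\int_{\mathbb{R}}e^{it\lambda}p(\lambda)\,d\lambda$. (ii) There are $\gamma\in(0,2)$ and $C_1>0$ with $p(\lambda)\le C_1|\lambda|^{-(1+\gamma)}$ for all $\lambda\ne0$. (iii) One of the following holds: (long-range dependence) $p(\lambda)=L(|\lambda|^{-1})|\lambda|^{H-1}$ with $H\in(0,1)$ and $L:(0,\infty)\to(0,\infty)$ locally bounded and slowly varying at infinity, i.e. $L(cr)/L(r)\to1$ as $r\to\infty$ for every $c>0$; or (short-range dependence) $p$ is bounded and continuous at the origin. **Wavelet and transform.** $\psi$ is complex-valued, nonzero, with $\widehat\psi(\omega)=\int_{\mathbb{R}}e^{-it\omega}\psi(t)\,dt=0$ for $\omega\le0$ (analyticity). $W_\Phi(t,s)=\int_{\mathbb{R}}\Phi(\tau)\frac1s\overline{\psi\left(\frac{\tau-t}{s}\right)}d\tau=\int_0^\infty e^{it\lambda}\overline{\widehat\psi(s\lambda)}\sqrt{p(\lambda)}\,Z(d\lambda)$ for $t\in\mathbb{R}$, $s>0$, where $Z$ is an orthogonally scattered complex Gaussian random measure on $\mathbb{R}$ with $Z(\Delta)=\overline{Z(-\Delta)}$, $\mathbb{E}[Z(\Delta)]=0$, $\mathbb{E}[Z(\Delta_1)\overline{Z(\Delta_2)}]=\mathrm{Leb}(\Delta_1\cap\Delta_2)$.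 The version of $s\mapsto W_\Phi(0,s)$ with continuous sample paths is used. $a\vee b=\max\{a,b\}$. *)

theory Defs
  imports "HOL-Probability.Probability"
begin

definition square_integrable :: "'w measure \<Rightarrow> ('w \<Rightarrow> complex) \<Rightarrow> bool" where
  "square_integrable M X \<longleftrightarrow>
     X \<in> borel_measurable M \<and> integrable M (\<lambda>\<omega>. (cmod (X \<omega>))\<^sup>2)"

definition ms_norm :: "'w measure \<Rightarrow> ('w \<Rightarrow> complex) \<Rightarrow> real" where
  "ms_norm M X = sqrt (LINT \<omega>|M. (cmod (X \<omega>))\<^sup>2)"

definition ms_simple :: "'w measure \<Rightarrow> (real \<Rightarrow> 'w \<Rightarrow> complex) \<Rightarrow> bool" where
  "ms_simple M S \<longleftrightarrow>
     simple_function lborel S \<and>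
     emeasure lborel {\<tau>. S \<tau> \<noteq> (\<lambda>_. 0)} \<noteq> \<infinity> \<and>
     (\<forall>\<tau>. square_integrable M (S \<tau>))"

text \<open>
  A (version of the) random variable \<open>X\<close> is the integral over the real line of the random function
  \<open>F\<close>: this is the Bochner integral in the Hilbert space of square-integrable random variables,
  spelled out as for \<^const>\<open>has_bochner_integral\<close> because that space is not a type. The integral of
  a simple \<open>S n\<close> is a finite linear combination of its values, so it may be written as an
  integral over \<open>\<tau>\<close> for each fixed \<open>\<omega>\<close>. No joint measurability of \<open>F\<close> is needed.
\<close>

definition has_ms_integral ::
  "'w measure \<Rightarrow> (real \<Rightarrow> 'w \<Rightarrow> complex) \<Rightarrow> ('w \<Rightarrow> complex) \<Rightarrow> bool" where
  "has_ms_integral M F X \<longleftrightarrow>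
     (\<forall>\<tau>. square_integrable M (F \<tau>)) \<and> square_integrable M X \<and>
     (\<exists>S. (\<forall>n::nat. ms_simple M (S n)) \<and>
        (\<forall>n. (\<lambda>\<tau>. ms_norm M (\<lambda>\<omega>. F \<tau> \<omega> - S n \<tau> \<omega>)) \<in> borel_measurable lborel) \<and>
        (\<lambda>n. \<integral>\<^sup>+\<tau>. ennreal (ms_norm M (\<lambda>\<omega>. F \<tau> \<omega> - S n \<tau> \<omega>)) \<partial>lborel) \<longlonglongrightarrow> 0 \<and>
        (\<lambda>n. ms_norm M (\<lambda>\<omega>. X \<omega> - (LINT \<tau>|lborel. S n \<tau> \<omega>))) \<longlonglongrightarrow> 0)"

text \<open>Degenerate (almost surely constant) Gaussian variables are allowed.\<close>

definition gaussian_rv :: "'w measure \<Rightarrow> ('w \<Rightarrow> real) \<Rightarrow> bool" where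
  "gaussian_rv M X \<longleftrightarrow>
     X \<in> borel_measurable M \<and>
     (\<exists>\<mu> \<sigma>. (\<sigma> > 0 \<and> distributed M lborel X (normal_density \<mu> \<sigma>)) \<or> (AE \<omega> in M. X \<omega> = \<mu>))"

definition gaussian_process :: "'w measure \<Rightarrow> (real \<Rightarrow> 'w \<Rightarrow> real) \<Rightarrow> bool" where
  "gaussian_process M \<Phi> \<longleftrightarrow>
     (\<forall>t. \<Phi> t \<in> borel_measurable M) \<and>
     (\<forall>J c. finite J \<longrightarrow> gaussian_rv M (\<lambda>\<omega>. \<Sum>t\<in>J. c t * \<Phi> t \<omega>))"

definition stationary_process :: "'w measure \<Rightarrow> (real \<Rightarrow> 'w \<Rightarrow> real) \<Rightarrow> bool" where
  "stationary_process M \<Phi> \<longleftrightarrow>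
     (\<forall>J h. finite J \<longrightarrow>
        distr M (\<Pi>\<^sub>M t\<in>J. borel) (\<lambda>\<omega>. \<lambda>t\<in>J. \<Phi> (t + h) \<omega>) =
        distr M (\<Pi>\<^sub>M t\<in>J. borel) (\<lambda>\<omega>. \<lambda>t\<in>J. \<Phi> t \<omega>))"

definition ms_continuous :: "'w measure \<Rightarrow> (real \<Rightarrow> 'w \<Rightarrow> real) \<Rightarrow> bool" where
  "ms_continuous M \<Phi> \<longleftrightarrow>
     (\<forall>t. integrable M (\<lambda>\<omega>. (\<Phi> t \<omega>)\<^sup>2)) \<and>
     (\<forall>t. ((\<lambda>u. LINT \<omega>|M. (\<Phi> u \<omega> - \<Phi> t \<omega>)\<^sup>2) \<longlongrightarrow> 0) (at t))"

definition covariance :: "'w measure \<Rightarrow> ('w \<Rightarrow> real) \<Rightarrow> ('w \<Rightarrow> real) \<Rightarrow> real" where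
  "covariance M X Y =
     (LINT \<omega>|M. (X \<omega> - (LINT \<omega>'|M. X \<omega>')) * (Y \<omega> - (LINT \<omega>'|M. Y \<omega>')))"

definition has_spectral_density ::
  "'w measure \<Rightarrow> (real \<Rightarrow> 'w \<Rightarrow> real) \<Rightarrow> (real \<Rightarrow> real) \<Rightarrow> bool" where
  "has_spectral_density M \<Phi> p \<longleftrightarrow>
     integrable lborel p \<and>
     (\<forall>t. complex_of_real (covariance M (\<Phi> t) (\<Phi> 0)) =
          (LINT l|lborel. exp (\<i> * of_real (t * l)) * of_real (p l)))"

definition slowly_varying :: "(real \<Rightarrow> real) \<Rightarrow> bool" where
  "slowly_varying L \<longleftrightarrow> (\<forall>c>0. ((\<lambda>r. L (c * r) / L r) \<longlongrightarrow> 1) at_top)"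

text \<open>Functions on the positive half-line are total here; their values elsewhere are irrelevant.\<close>

definition long_range_dependent :: "(real \<Rightarrow> real) \<Rightarrow> real \<Rightarrow> bool" where
  "long_range_dependent p H \<longleftrightarrow>
     0 < H \<and> H < 1 \<and>
     (\<exists>L. (\<forall>r>0. L r > 0) \<and>
          (\<forall>K. compact K \<and> K \<subseteq> {0<..} \<longrightarrow> bounded (L ` K)) \<and>
          slowly_varying L \<and>
          (\<forall>l. l \<noteq> 0 \<longrightarrow> p l = L (inverse \<bar>l\<bar>) * \<bar>l\<bar> powr (H - 1)))"

definition short_range_dependent :: "(real \<Rightarrow> real) \<Rightarrow> bool" where
  "short_range_dependent p \<longleftrightarrow> bounded (range p) \<and> isCont p 0"

definition fourier :: "(real \<Rightarrow> complex) \<Rightarrow> real \<Rightarrow> complex" where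
  "fourier \<psi> w = (LINT t|lborel. exp (- (\<i> * of_real (t * w))) * \<psi> t)"

definition analytic_wavelet :: "(real \<Rightarrow> complex) \<Rightarrow> bool" where
  "analytic_wavelet \<psi> \<longleftrightarrow>
     \<not> (AE t in lborel. \<psi> t = 0) \<and> (\<forall>w\<le>0. fourier \<psi> w = 0)"

text \<open>Bounded whenever \<open>f\<close> is the Fourier transform of an integrable function.\<close>

definition sup_norm :: "(real \<Rightarrow> complex) \<Rightarrow> real" where
  "sup_norm f = (SUP w. cmod (f w))"

text \<open>The least Lipschitz constant on the closed half-line, for functions that have one.\<close>

definition lip_seminorm :: "(real \<Rightarrow> complex) \<Rightarrow> real" where
  "lip_seminorm f = Inf {K. K-lipschitz_on {0..} f}"

text \<open>\<open>X\<close> is a version of the wavelet transform of \<open>\<Phi>\<close> at time \<open>t\<close> and scale \<open>s\<close>.\<close>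

definition is_wavelet_transform_at ::
  "'w measure \<Rightarrow> (real \<Rightarrow> complex) \<Rightarrow> (real \<Rightarrow> 'w \<Rightarrow> real) \<Rightarrow> real \<Rightarrow> real \<Rightarrow> ('w \<Rightarrow> complex) \<Rightarrow> bool"
  where
  "is_wavelet_transform_at M \<psi> \<Phi> t s X \<longleftrightarrow>
     has_ms_integral M
       (\<lambda>\<tau> \<omega>. of_real (\<Phi> \<tau> \<omega>) * (of_real (1 / s) * cnj (\<psi> ((\<tau> - t) / s)))) X"

end

theory Submission
  imports Defs
begin

text \<open>
  The bound is Dudley chaining over the scales \<open>[0, \<infinity>)\<close>, where the transform is set to zero at
  scale zero. As a mean-square limit of finite linear combinations of values of \<open>\<Phi>\<close>, each
  increment of \<open>W\<close> has Gaussian real and imaginary parts, centred because \<open>\<psi>\<close> has integral zero.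
  Its second moment is the integral of \<open>cmod (fourier \<psi> (s * l) - fourier \<psi> (t * l))\<^sup>2 * p l\<close>.
  Bounding the difference of Fourier transforms by twice the supremum norm for large \<open>l\<close>, and by the
  Lipschitz estimate for small \<open>l\<close>, gives a Hoelder bound with constant \<open>C\<^sub>2\<close> and exponent \<open>\<gamma> / 2\<close>.
  The net of level \<open>k\<close> consists of the multiples of \<open>(D powr (- k) / C\<^sub>2) powr (2 / \<gamma>)\<close> up to
  \<open>T * D powr (2 * k / Hm)\<close>. Its point \<open>0\<close> also serves all larger scales, since by the decay
  hypothesis the variance is at most \<open>D powr (- 2 * k)\<close> there.
\<close>

section \<open>Square-integrable random variables\<close>

text \<open>The process is not assumed jointly measurable in time and outcome, so Fubini on the
  product of the time line and the probability space is out of reach. Pairing with a fixed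
  square-integrable variable turns the process into a continuous deterministic function of time.
  Centring and the second-moment formula are read off from such pairings, and Fubini is applied only
  to functions of time and frequency. \<open>D\<close> has two jobs: it bounds the standard
  deviation at the root of the chain, and it is the ratio between successive accuracies.
  \<open>D \<ge> 2\<close> makes the geometric series converge and lets \<open>ln D\<close> absorb
  the numerical constants in the logarithm of the net size. The leading 4 of the bound is a factor 2
  from the maximal inequality times a factor 2 from the estimate of the square-root entropy.\<close>

lemma square_integrable_measurable [measurable_dest]:
  "square_integrable M X \<Longrightarrow> X \<in> borel_measurable M"
  by (simp add: square_integrable_def)

lemma square_integrable_cmod_mult:
  assumes "square_integrable M X" "square_integrable M Y"
  shows "integrable M (\<lambda>\<omega>. cmod (X \<omega>) * cmod (Y \<omega>))"
proof (rule Bochner_Integration.integrable_bound)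
  show "integrable M (\<lambda>\<omega>. (cmod (X \<omega>))\<^sup>2 + (cmod (Y \<omega>))\<^sup>2)"
    using assms by (simp add: square_integrable_def)
  show "(\<lambda>\<omega>. cmod (X \<omega>) * cmod (Y \<omega>)) \<in> borel_measurable M"
    using assms[THEN square_integrable_measurable] by measurable
  have "a * b \<le> a\<^sup>2 + b\<^sup>2" if "a \<ge> 0" "b \<ge> 0" for a b :: real
    using sum_squares_bound[of a b] mult_nonneg_nonneg[OF that] by linarith
  then show "AE \<omega> in M. norm (cmod (X \<omega>) * cmod (Y \<omega>)) \<le> norm ((cmod (X \<omega>))\<^sup>2 + (cmod (Y \<omega>))\<^sup>2)"
    by simp
qed

lemma square_integrable_mult_cnj:
  assumes "square_integrable M X" "square_integrable M Y"
  shows "integrable M (\<lambda>\<omega>. X \<omega> * cnj (Y \<omega>))"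
proof (rule Bochner_Integration.integrable_bound[OF square_integrable_cmod_mult[OF assms]])
  show "(\<lambda>\<omega>. X \<omega> * cnj (Y \<omega>)) \<in> borel_measurable M"
    using assms by (auto simp: square_integrable_def intro!: borel_measurable_times
        borel_measurable_continuous_on[where f = cnj] continuous_intros)
qed (simp add: norm_mult)

lemma ms_norm_nonneg: "ms_norm M X \<ge> 0"
  by (simp add: ms_norm_def)

lemma ms_norm_power2: "(ms_norm M X)\<^sup>2 = (LINT \<omega>|M. (cmod (X \<omega>))\<^sup>2)"
  by (simp add: ms_norm_def)

lemma ms_norm_minus: "ms_norm M (\<lambda>\<omega>. X \<omega> - Y \<omega>) = ms_norm M (\<lambda>\<omega>. Y \<omega> - X \<omega>)"
  by (simp add: ms_norm_def norm_minus_commute)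

lemma ms_norm_scale: "ms_norm M (\<lambda>\<omega>. c * X \<omega>) = cmod c * ms_norm M X"
  by (simp add: ms_norm_def norm_mult power_mult_distrib real_sqrt_mult)

lemma square_integrable_add:
  assumes "square_integrable M X" "square_integrable M Y"
  shows "square_integrable M (\<lambda>\<omega>. X \<omega> + Y \<omega>)"
  unfolding square_integrable_def
proof
  show "(\<lambda>\<omega>. X \<omega> + Y \<omega>) \<in> borel_measurable M"
    using assms[THEN square_integrable_measurable] by measurable
  show "integrable M (\<lambda>\<omega>. (cmod (X \<omega> + Y \<omega>))\<^sup>2)"
  proof (rule Bochner_Integration.integrable_bound)
    show "integrable M (\<lambda>\<omega>. 2 * ((cmod (X \<omega>))\<^sup>2 + (cmod (Y \<omega>))\<^sup>2))"
      using assms by (simp add: square_integrable_def)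
    show "(\<lambda>\<omega>. (cmod (X \<omega> + Y \<omega>))\<^sup>2) \<in> borel_measurable M"
      using assms[THEN square_integrable_measurable] by measurable
    have "(cmod (x + y))\<^sup>2 \<le> 2 * ((cmod x)\<^sup>2 + (cmod y)\<^sup>2)" for x y
    proof -
      have "(cmod (x + y))\<^sup>2 \<le> (cmod x + cmod y)\<^sup>2"
        by (intro power_mono norm_triangle_ineq) simp
      also have "\<dots> \<le> 2 * ((cmod x)\<^sup>2 + (cmod y)\<^sup>2)"
        using sum_squares_bound[of "cmod x" "cmod y"] by (simp add: power2_sum)
      finally show ?thesis .
    qed
    then show "AE \<omega> in M. norm ((cmod (X \<omega> + Y \<omega>))\<^sup>2)
        \<le> norm (2 * ((cmod (X \<omega>))\<^sup>2 + (cmod (Y \<omega>))\<^sup>2))"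
      by simp
  qed
qed

lemma square_integrable_scale:
  assumes "square_integrable M X"
  shows "square_integrable M (\<lambda>\<omega>. c * X \<omega>)"
  using assms
  by (auto simp: square_integrable_def norm_mult power_mult_distrib intro!: borel_measurable_times)

lemma square_integrable_diff:
  assumes "square_integrable M X" "square_integrable M Y"
  shows "square_integrable M (\<lambda>\<omega>. X \<omega> - Y \<omega>)"
  using square_integrable_add[OF assms(1) square_integrable_scale[OF assms(2), of "-1"]] by simp

lemma square_integrable_zero: "square_integrable M (\<lambda>_. 0)"
  by (simp add: square_integrable_def)

lemma square_integrable_sum:
  assumes "\<And>i. i \<in> I \<Longrightarrow> square_integrable M (X i)"
  shows "square_integrable M (\<lambda>\<omega>. \<Sum>i\<in>I. X i \<omega>)"
  using assms
  by (induction I rule: infinite_finite_induct)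
    (auto simp: square_integrable_zero intro!: square_integrable_add)

lemma (in prob_space) square_integrable_const: "square_integrable M (\<lambda>_. c)"
  by (simp add: square_integrable_def)

lemma (in prob_space) ms_integrable:
  assumes "square_integrable M X"
  shows "integrable M X"
  using square_integrable_mult_cnj[OF assms square_integrable_const[of 1]] by simp

lemma ms_cauchy_schwarz:
  assumes X: "square_integrable M X" and Y: "square_integrable M Y"
  shows "(LINT \<omega>|M. cmod (X \<omega>) * cmod (Y \<omega>)) \<le> ms_norm M X * ms_norm M Y"
proof -
  \<comment> \<open>Zero norms are split off because the weights used below divide by both norms; a
    zero norm forces that factor to vanish almost everywhere.\<close>
  have null: "(LINT \<omega>|M. cmod (A \<omega>) * cmod (B \<omega>)) = 0"
    if "ms_norm M A = 0" and A: "square_integrable M A" for A B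
  proof -
    have "(LINT \<omega>|M. (cmod (A \<omega>))\<^sup>2) = 0"
      using that ms_norm_power2[of M A] by simp
    then have "AE \<omega> in M. (cmod (A \<omega>))\<^sup>2 = 0"
      using A by (subst (asm) integral_nonneg_eq_0_iff_AE) (auto simp: square_integrable_def)
    then have "AE \<omega> in M. cmod (A \<omega>) * cmod (B \<omega>) = 0"
      by eventually_elim simp
    then show ?thesis
      by (rule integral_eq_zero_AE)
  qed
  define a b where "a = ms_norm M X" and "b = ms_norm M Y"
  consider "a = 0" | "b = 0" | "a > 0" "b > 0"
    using ms_norm_nonneg unfolding a_def b_def by (metis less_eq_real_def)
  then show ?thesis
  proof cases
    case 1
    with null[of X Y] X show ?thesis by (simp add: a_def)
  next
    case 2
    with null[of Y X] Y show ?thesis by (simp add: b_def mult.commute)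
  next
    case 3
    \<comment> \<open>Weighted AM-GM: the weights are chosen so that each of the two squares
      contributes exactly half of \<open>a * b\<close>.\<close>
    have "(LINT \<omega>|M. cmod (X \<omega>) * cmod (Y \<omega>))
        \<le> (LINT \<omega>|M. (b / a / 2) * (cmod (X \<omega>))\<^sup>2 + (a / b / 2) * (cmod (Y \<omega>))\<^sup>2)"
    proof (rule integral_mono)
      fix \<omega>
      have "0 \<le> (b * cmod (X \<omega>) - a * cmod (Y \<omega>))\<^sup>2"
        by simp
      then have "2 * (a * b) * (cmod (X \<omega>) * cmod (Y \<omega>))
          \<le> b\<^sup>2 * (cmod (X \<omega>))\<^sup>2 + a\<^sup>2 * (cmod (Y \<omega>))\<^sup>2"
        by (simp add: power2_eq_square algebra_simps)
      then show "cmod (X \<omega>) * cmod (Y \<omega>)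
          \<le> (b / a / 2) * (cmod (X \<omega>))\<^sup>2 + (a / b / 2) * (cmod (Y \<omega>))\<^sup>2"
        using 3 by (simp add: field_simps power2_eq_square)
    qed (use X Y square_integrable_cmod_mult[OF X Y] in \<open>auto simp: square_integrable_def\<close>)
    also have "\<dots> = (b / a / 2) * a\<^sup>2 + (a / b / 2) * b\<^sup>2"
      using X Y by (simp add: square_integrable_def a_def b_def ms_norm_power2)
    also have "\<dots> = a * b"
      using 3 by (simp add: power2_eq_square)
    finally show ?thesis by (simp add: a_def b_def)
  qed
qed

lemma ms_inner_le:
  assumes X: "square_integrable M X" and Y: "square_integrable M Y"
  shows "cmod (LINT \<omega>|M. X \<omega> * cnj (Y \<omega>)) \<le> ms_norm M X * ms_norm M Y"
  using integral_norm_bound[of M "\<lambda>\<omega>. X \<omega> * cnj (Y \<omega>)"] ms_cauchy_schwarz[OF X Y]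
  by (simp add: norm_mult)

lemma ms_norm_triangle:
  assumes X: "square_integrable M X" and Y: "square_integrable M Y"
  shows "ms_norm M (\<lambda>\<omega>. X \<omega> + Y \<omega>) \<le> ms_norm M X + ms_norm M Y"
proof -
  note XY = square_integrable_cmod_mult[OF X Y]
  have "(ms_norm M (\<lambda>\<omega>. X \<omega> + Y \<omega>))\<^sup>2
      \<le> (LINT \<omega>|M. (cmod (X \<omega>))\<^sup>2 + (cmod (Y \<omega>))\<^sup>2 + 2 * (cmod (X \<omega>) * cmod (Y \<omega>)))"
    unfolding ms_norm_power2
  proof (rule integral_mono)
    fix \<omega>
    have "(cmod (X \<omega> + Y \<omega>))\<^sup>2 \<le> (cmod (X \<omega>) + cmod (Y \<omega>))\<^sup>2"
      by (intro power_mono norm_triangle_ineq) simp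
    then show "(cmod (X \<omega> + Y \<omega>))\<^sup>2
        \<le> (cmod (X \<omega>))\<^sup>2 + (cmod (Y \<omega>))\<^sup>2 + 2 * (cmod (X \<omega>) * cmod (Y \<omega>))"
      by (simp add: power2_sum)
  qed (use X Y XY square_integrable_add[OF X Y] in \<open>auto simp: square_integrable_def\<close>)
  also have "\<dots> = (ms_norm M X)\<^sup>2 + (ms_norm M Y)\<^sup>2 + 2 * (LINT \<omega>|M. cmod (X \<omega>) * cmod (Y \<omega>))"
    using X Y XY by (simp add: square_integrable_def ms_norm_power2)
  also have "\<dots> \<le> (ms_norm M X + ms_norm M Y)\<^sup>2"
    using ms_cauchy_schwarz[OF X Y] by (simp add: power2_sum)
  finally show ?thesis
    by (rule power2_le_imp_le) (simp add: ms_norm_nonneg)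
qed

lemma ms_norm_sum_le:
  assumes "\<And>i. i \<in> I \<Longrightarrow> square_integrable M (X i)"
  shows "ms_norm M (\<lambda>\<omega>. \<Sum>i\<in>I. X i \<omega>) \<le> (\<Sum>i\<in>I. ms_norm M (X i))"
  using assms
proof (induction I rule: infinite_finite_induct)
  case (insert i I)
  have "ms_norm M (\<lambda>\<omega>. X i \<omega> + (\<Sum>i\<in>I. X i \<omega>))
      \<le> ms_norm M (X i) + ms_norm M (\<lambda>\<omega>. \<Sum>i\<in>I. X i \<omega>)"
    using insert.prems by (intro ms_norm_triangle square_integrable_sum) auto
  with insert show ?case by fastforce
qed (simp_all add: ms_norm_def)

lemma ms_norm_triangle_diff:
  assumes "square_integrable M X" "square_integrable M Y" "square_integrable M Z"
  shows "ms_norm M (\<lambda>\<omega>. X \<omega> - Z \<omega>)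
    \<le> ms_norm M (\<lambda>\<omega>. X \<omega> - Y \<omega>) + ms_norm M (\<lambda>\<omega>. Y \<omega> - Z \<omega>)"
  using ms_norm_triangle[OF square_integrable_diff[OF assms(1,2)]
      square_integrable_diff[OF assms(2,3)]] by simp

section \<open>Mean-square integrals\<close>

text \<open>Nonzero level sets lie in the support, which has finite measure. The level set of zero
  is the rest of the line and has to be left out.\<close>

lemma ms_simple_level:
  assumes "ms_simple M S"
  shows "finite (range S)" "S -` {v} \<in> sets lborel"
    "v \<noteq> (\<lambda>_. 0) \<Longrightarrow> emeasure lborel (S -` {v}) < \<infinity>"
    "v \<in> range S \<Longrightarrow> square_integrable M v"
proof -
  show fin: "finite (range S)"
    using assms by (auto simp: ms_simple_def simple_function_def)
  show meas: "S -` {v} \<in> sets lborel" for v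
  proof (cases "v \<in> range S")
    case False
    then have "S -` {v} = {}" by auto
    then show ?thesis by simp
  qed (use assms in \<open>auto simp: ms_simple_def simple_function_def\<close>)
  show "square_integrable M v" if "v \<in> range S"
    using assms that by (auto simp: ms_simple_def)
  assume v: "v \<noteq> (\<lambda>_. 0)"
  have "{\<tau>. S \<tau> \<noteq> (\<lambda>_. 0)} = (\<Union>v\<in>range S - {\<lambda>_. 0}. S -` {v})"
    by auto
  moreover have "(\<Union>v\<in>range S - {\<lambda>_. 0}. S -` {v}) \<in> sets lborel"
    using fin meas by (intro sets.finite_UN) auto
  ultimately have "emeasure lborel (S -` {v}) \<le> emeasure lborel {\<tau>. S \<tau> \<noteq> (\<lambda>_. 0)}"
    using v by (intro emeasure_mono) auto
  then show "emeasure lborel (S -` {v}) < \<infinity>"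
    using assms by (auto simp: ms_simple_def top.not_eq_extremum intro: le_less_trans)
qed

text \<open>Each \<open>\<tau>\<close> lies in exactly one level set, so \<open>\<phi>\<close> acts
  on the values one at a time; \<open>\<phi>\<close> must kill zero because that level set has
  infinite measure. The two functionals of interest are evaluation at an outcome and pairing with a
  fixed variable, so both integrals become finite sums with the same weights.\<close>

lemma ms_simple_has_integral:
  fixes S :: "real \<Rightarrow> 'w \<Rightarrow> complex" and \<phi> :: "('w \<Rightarrow> complex) \<Rightarrow> complex"
  assumes S: "ms_simple M S" and \<phi>0: "\<phi> (\<lambda>_. 0) = 0"
  shows "has_bochner_integral lborel (\<lambda>\<tau>. \<phi> (S \<tau>))
    (\<Sum>v\<in>range S - {\<lambda>_. 0}. of_real (measure lborel (S -` {v})) * \<phi> v)"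
proof -
  define V where "V = range S - {\<lambda>_. 0}"
  note level = ms_simple_level[OF S]
  have fin: "finite V"
    using level(1) by (simp add: V_def)
  have "has_bochner_integral lborel (\<lambda>\<tau>. \<Sum>v\<in>V. indicator (S -` {v}) \<tau> *\<^sub>R \<phi> v)
      (\<Sum>v\<in>V. measure lborel (S -` {v}) *\<^sub>R \<phi> v)"
    by (intro has_bochner_integral_sum has_bochner_integral_scaleR_left
        has_bochner_integral_real_indicator level(2,3)) (simp add: V_def)
  also have "(\<lambda>\<tau>. \<Sum>v\<in>V. indicator (S -` {v}) \<tau> *\<^sub>R \<phi> v) = (\<lambda>\<tau>. \<phi> (S \<tau>))"
  proof
    fix \<tau>
    have "(\<Sum>v\<in>V. indicator (S -` {v}) \<tau> *\<^sub>R \<phi> v) = (\<Sum>v\<in>V. if v = S \<tau> then \<phi> v else 0)"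
      by (intro sum.cong) (auto simp: indicator_def)
    also have "\<dots> = \<phi> (S \<tau>)"
      using fin \<phi>0 by (auto simp: V_def sum.delta)
    finally show "(\<Sum>v\<in>V. indicator (S -` {v}) \<tau> *\<^sub>R \<phi> v) = \<phi> (S \<tau>)" .
  qed
  finally show ?thesis
    by (simp add: V_def scaleR_conv_of_real)
qed

text \<open>If \<open>f\<close> exceeded its mean everywhere on \<open>A\<close>, its integral over
  \<open>A\<close> would exceed itself. This supplies sample points whose error is controlled by an
  integral.\<close>

lemma exists_le_average:
  fixes f :: "'a \<Rightarrow> real"
  assumes f: "f \<in> borel_measurable N" and A: "A \<in> sets N" "A \<noteq> {}" "emeasure N A < \<infinity>"
    and pos: "\<And>x. f x \<ge> 0"
  shows "\<exists>x\<in>A. ennreal (measure N A * f x) \<le> (\<integral>\<^sup>+x. ennreal (f x) * indicator A x \<partial>N)"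
proof (rule ccontr)
  define I where "I = (\<integral>\<^sup>+x. ennreal (f x) * indicator A x \<partial>N)"
  assume "\<not> ?thesis"
  then have less: "I < ennreal (measure N A * f x)" if "x \<in> A" for x
    using that by (auto simp: not_le I_def)
  obtain y where y: "y \<in> A"
    using A(2) by auto
  \<comment> \<open>The negated claim puts \<open>I\<close> strictly below a real number, so
    \<open>I\<close> is finite; since \<open>I\<close> is not negative, it also excludes measure
    zero, and the mean \<open>c\<close> is meaningful.\<close>
  have fin: "I < \<infinity>"
    using less[OF y] by (rule less_trans) simp
  have m: "measure N A > 0"
    using less[OF y] measure_nonneg[of N A] by (cases "measure N A = 0") (auto simp: less_le)
  define c where "c = enn2real I / measure N A"
  have Ic: "I = ennreal (measure N A * c)"
    using fin m by (simp add: c_def)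
  have c0: "c \<ge> 0"
    using m by (simp add: c_def)
  have cf: "c < f x" if "x \<in> A" for x
    using less[OF that] m c0 unfolding Ic by (simp add: ennreal_less_iff)
  have em: "emeasure N A = ennreal (measure N A)"
    using A(3) by (simp add: emeasure_eq_ennreal_measure less_top)
  have cI: "(\<integral>\<^sup>+x. ennreal c * indicator A x \<partial>N) = I"
    using c0 by (simp only: nn_integral_cmult_indicator[OF A(1)] em Ic)
      (simp add: ennreal_mult mult.commute)
  have "(\<integral>\<^sup>+x. ennreal c * indicator A x \<partial>N) < (\<integral>\<^sup>+x. ennreal (f x) * indicator A x \<partial>N)"
  proof (rule nn_integral_less)
    show "(\<integral>\<^sup>+x. ennreal c * indicator A x \<partial>N) \<noteq> \<infinity>"
      using fin cI by simp
    show "AE x in N. ennreal c * indicator A x \<le> ennreal (f x) * indicator A x"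
      using cf by (intro AE_I2) (auto simp: indicator_def ennreal_leI less_imp_le)
    show "\<not> (AE x in N. ennreal (f x) * indicator A x \<le> ennreal c * indicator A x)"
    proof
      assume "AE x in N. ennreal (f x) * indicator A x \<le> ennreal c * indicator A x"
      then have "AE x in N. x \<notin> A"
      proof eventually_elim
        case (elim x)
        then show ?case
          using cf[of x] c0 by (auto simp: indicator_def ennreal_le_iff split: if_splits)
      qed
      then have "emeasure N A = 0"
        using A(1) by (subst (asm) AE_iff_measurable[OF A(1)]) (use A(1) sets.sets_into_space in auto)
      with m em show False
        by simp
    qed
  qed (use f A in measurable)
  then show False
    unfolding cI by (simp add: I_def)
qed

text \<open>The mean-square closure of the complex linear span of the process. As
  \<open>\<Phi>\<close> is real, the real part of any complex multiple of an approximant is a real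
  combination of values of \<open>\<Phi>\<close>, hence Gaussian.\<close>

definition in_closed_span ::
  "'w measure \<Rightarrow> (real \<Rightarrow> 'w \<Rightarrow> real) \<Rightarrow> ('w \<Rightarrow> complex) \<Rightarrow> bool" where
  "in_closed_span M \<Phi> X \<longleftrightarrow> square_integrable M X \<and>
     (\<forall>e>0. \<exists>J c. finite J \<and> ms_norm M (\<lambda>\<omega>. X \<omega> - (\<Sum>t\<in>J. c t * of_real (\<Phi> t \<omega>))) < e)"

text \<open>Each value of an approximating simple function is replaced by a nearby value of the
  integrand itself, chosen on the same level set.\<close>

lemma ms_integral_in_closed_span:
  assumes int: "has_ms_integral M (\<lambda>\<tau> \<omega>. of_real (\<Phi> \<tau> \<omega>) * g \<tau>) X"
  shows "in_closed_span M \<Phi> X"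
  unfolding in_closed_span_def
proof (intro conjI allI impI)
  define F where "F = (\<lambda>\<tau> \<omega>. complex_of_real (\<Phi> \<tau> \<omega>) * g \<tau>)"
  have F: "square_integrable M (F \<tau>)" for \<tau>
    using int by (simp add: has_ms_integral_def F_def)
  show X: "square_integrable M X"
    using int by (simp add: has_ms_integral_def)
  fix e :: real assume e: "e > 0"
  obtain S where S: "\<And>n. ms_simple M (S n)"
    and fm: "\<And>n. (\<lambda>\<tau>. ms_norm M (\<lambda>\<omega>. F \<tau> \<omega> - S n \<tau> \<omega>)) \<in> borel_measurable lborel"
    and lim1: "(\<lambda>n. \<integral>\<^sup>+\<tau>. ennreal (ms_norm M (\<lambda>\<omega>. F \<tau> \<omega> - S n \<tau> \<omega>)) \<partial>lborel) \<longlonglongrightarrow> 0"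
    and lim2: "(\<lambda>n. ms_norm M (\<lambda>\<omega>. X \<omega> - (LINT \<tau>|lborel. S n \<tau> \<omega>))) \<longlonglongrightarrow> 0"
    using int unfolding has_ms_integral_def F_def by blast
  have "\<forall>\<^sub>F n in sequentially.
      (\<integral>\<^sup>+\<tau>. ennreal (ms_norm M (\<lambda>\<omega>. F \<tau> \<omega> - S n \<tau> \<omega>)) \<partial>lborel) < ennreal (e / 2)"
    using e by (intro order_tendstoD(2)[OF lim1]) simp
  moreover have "\<forall>\<^sub>F n in sequentially. ms_norm M (\<lambda>\<omega>. X \<omega> - (LINT \<tau>|lborel. S n \<tau> \<omega>)) < e / 2"
    using e by (intro order_tendstoD(2)[OF lim2]) simp
  ultimately have "\<forall>\<^sub>F n in sequentially.
      (\<integral>\<^sup>+\<tau>. ennreal (ms_norm M (\<lambda>\<omega>. F \<tau> \<omega> - S n \<tau> \<omega>)) \<partial>lborel) < ennreal (e / 2) \<and>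
      ms_norm M (\<lambda>\<omega>. X \<omega> - (LINT \<tau>|lborel. S n \<tau> \<omega>)) < e / 2"
    by (rule eventually_conj)
  then obtain n where
    n1: "(\<integral>\<^sup>+\<tau>. ennreal (ms_norm M (\<lambda>\<omega>. F \<tau> \<omega> - S n \<tau> \<omega>)) \<partial>lborel) < ennreal (e / 2)" and
    n2: "ms_norm M (\<lambda>\<omega>. X \<omega> - (LINT \<tau>|lborel. S n \<tau> \<omega>)) < e / 2"
    using eventually_happens trivial_limit_sequentially by blast
  define s where "s = S n"
  define f where "f = (\<lambda>\<tau>. ms_norm M (\<lambda>\<omega>. F \<tau> \<omega> - s \<tau> \<omega>))"
  define V where "V = range s - {\<lambda>_. 0}"
  note s = ms_simple_level[OF S[of n], folded s_def]
  have finV: "finite V"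
    using s(1) by (simp add: V_def)
  have fmeas: "f \<in> borel_measurable lborel"
    using fm[of n] by (simp add: f_def s_def)
  \<comment> \<open>The sample time of a level set is one where the error does not exceed its mean
    over that set, so the total sampling error is bounded by an integral of
    \<open>f\<close>.\<close>
  have "\<forall>v\<in>V. \<exists>\<tau>. \<tau> \<in> s -` {v} \<and> ennreal (measure lborel (s -` {v}) * f \<tau>)
      \<le> (\<integral>\<^sup>+\<tau>. ennreal (f \<tau>) * indicator (s -` {v}) \<tau> \<partial>lborel)"
  proof
    fix v assume "v \<in> V"
    then have "\<exists>\<tau>\<in>s -` {v}. ennreal (measure lborel (s -` {v}) * f \<tau>)
        \<le> (\<integral>\<^sup>+\<tau>. ennreal (f \<tau>) * indicator (s -` {v}) \<tau> \<partial>lborel)"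
      using s(2,3) by (intro exists_le_average fmeas) (auto simp: V_def f_def ms_norm_nonneg)
    then show "\<exists>\<tau>. \<tau> \<in> s -` {v} \<and> ennreal (measure lborel (s -` {v}) * f \<tau>)
        \<le> (\<integral>\<^sup>+\<tau>. ennreal (f \<tau>) * indicator (s -` {v}) \<tau> \<partial>lborel)"
      by blast
  qed
  then obtain t where t': "\<forall>v\<in>V. t v \<in> s -` {v} \<and> ennreal (measure lborel (s -` {v}) * f (t v))
      \<le> (\<integral>\<^sup>+\<tau>. ennreal (f \<tau>) * indicator (s -` {v}) \<tau> \<partial>lborel)"
    by (rule bchoice[THEN exE])
  then have t: "s (t v) = v"
    and tle: "ennreal (measure lborel (s -` {v}) * f (t v))
      \<le> (\<integral>\<^sup>+\<tau>. ennreal (f \<tau>) * indicator (s -` {v}) \<tau> \<partial>lborel)" if "v \<in> V" for v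
    using that by auto
  \<comment> \<open>Distinct values have disjoint level sets, so the sample times differ and the
    coefficients of the Riemann sum \<open>Y\<close> can be indexed by time.\<close>
  have inj: "inj_on t V"
    using t by (rule inj_on_inverseI)
  define m where "m v = measure lborel (s -` {v})" for v
  define c where "c = (\<lambda>\<tau>. of_real (m (s \<tau>)) * g \<tau>)"
  define Y where "Y = (\<lambda>\<omega>. \<Sum>\<tau>\<in>t ` V. c \<tau> * of_real (\<Phi> \<tau> \<omega>))"
  have Yeq: "Y \<omega> = (\<Sum>v\<in>V. of_real (m v) * F (t v) \<omega>)" for \<omega>
    unfolding Y_def using inj t
    by (simp add: sum.reindex c_def F_def mult_ac)
  have sint: "(LINT \<tau>|lborel. s \<tau> \<omega>) = (\<Sum>v\<in>V. of_real (m v) * v \<omega>)" for \<omega>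
    using ms_simple_has_integral[OF S[of n], of "\<lambda>v. v \<omega>"]
    by (auto simp: s_def V_def m_def dest: has_bochner_integral_integral_eq)
  have sqV: "square_integrable M v" if "v \<in> V" for v
    using s(4) that by (simp add: V_def)
  have sqD: "square_integrable M (\<lambda>\<omega>. of_real (m v) * (v \<omega> - F (t v) \<omega>))" if "v \<in> V" for v
    using sqV[OF that] F by (intro square_integrable_scale square_integrable_diff)
  have "ms_norm M (\<lambda>\<omega>. (LINT \<tau>|lborel. s \<tau> \<omega>) - Y \<omega>)
      = ms_norm M (\<lambda>\<omega>. \<Sum>v\<in>V. of_real (m v) * (v \<omega> - F (t v) \<omega>))"
    by (simp add: sint Yeq sum_subtractf right_diff_distrib)
  also have "\<dots> \<le> (\<Sum>v\<in>V. ms_norm M (\<lambda>\<omega>. of_real (m v) * (v \<omega> - F (t v) \<omega>)))"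
    by (intro ms_norm_sum_le sqD)
  also have "\<dots> = (\<Sum>v\<in>V. m v * f (t v))"
    using t by (intro sum.cong refl, subst ms_norm_scale)
      (simp add: f_def m_def ms_norm_minus[of M _ "F _"] )
  finally have le: "ms_norm M (\<lambda>\<omega>. (LINT \<tau>|lborel. s \<tau> \<omega>) - Y \<omega>) \<le> (\<Sum>v\<in>V. m v * f (t v))" .
  \<comment> \<open>Disjointness of the level sets is what keeps the sum of the partial integrals
    below the integral over the whole line.\<close>
  have "ennreal (\<Sum>v\<in>V. m v * f (t v)) = (\<Sum>v\<in>V. ennreal (m v * f (t v)))"
    by (intro sum_ennreal[symmetric]) (simp add: f_def m_def ms_norm_nonneg)
  also have "\<dots> \<le> (\<Sum>v\<in>V. \<integral>\<^sup>+\<tau>. ennreal (f \<tau>) * indicator (s -` {v}) \<tau> \<partial>lborel)"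
    using tle by (intro sum_mono) (simp add: m_def)
  also have "\<dots> = (\<integral>\<^sup>+\<tau>. (\<Sum>v\<in>V. ennreal (f \<tau>) * indicator (s -` {v}) \<tau>) \<partial>lborel)"
    using fmeas s(2)
    by (intro nn_integral_sum[symmetric] borel_measurable_times borel_measurable_indicator) auto
  also have "\<dots> \<le> (\<integral>\<^sup>+\<tau>. ennreal (f \<tau>) \<partial>lborel)"
  proof (rule nn_integral_mono)
    fix \<tau>
    have "(\<Sum>v\<in>V. ennreal (f \<tau>) * indicator (s -` {v}) \<tau>)
        = (\<Sum>v\<in>V. if v = s \<tau> then ennreal (f \<tau>) else 0)"
      by (intro sum.cong) (auto simp: indicator_def)
    also have "\<dots> \<le> ennreal (f \<tau>)"
      using finV by (simp add: sum.delta)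
    finally show "(\<Sum>v\<in>V. ennreal (f \<tau>) * indicator (s -` {v}) \<tau>) \<le> ennreal (f \<tau>)" .
  qed
  also have "\<dots> < ennreal (e / 2)"
    using n1 by (simp add: f_def s_def)
  finally have "(\<Sum>v\<in>V. m v * f (t v)) < e / 2"
    using e by (simp add: ennreal_less_iff sum_nonneg f_def m_def ms_norm_nonneg)
  with le have le2: "ms_norm M (\<lambda>\<omega>. (LINT \<tau>|lborel. s \<tau> \<omega>) - Y \<omega>) < e / 2"
    by simp
  have "square_integrable M (\<lambda>\<omega>. LINT \<tau>|lborel. s \<tau> \<omega>)" "square_integrable M Y"
    unfolding sint Yeq using sqV F by (auto intro!: square_integrable_sum square_integrable_scale)
  then have "ms_norm M (\<lambda>\<omega>. X \<omega> - Y \<omega>) < e"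
    using ms_norm_triangle_diff[OF X, of "\<lambda>\<omega>. LINT \<tau>|lborel. s \<tau> \<omega>" Y] n2 le2
    by (simp add: s_def)
  then show "\<exists>J c. finite J \<and> ms_norm M (\<lambda>\<omega>. X \<omega> - (\<Sum>t\<in>J. c t * of_real (\<Phi> t \<omega>))) < e"
    using finV by (intro exI[of _ "t ` V"] exI[of _ c]) (simp add: Y_def)
qed

text \<open>For a simple function the exchange of expectation and time integral is a finite sum. By
  Cauchy-Schwarz both sides differ from their simple counterparts by at most the norm of
  \<open>Y\<close> times an approximation error, and both errors tend to zero. Hypothesis
  \<open>h\<close> gives the right-hand side its meaning.\<close>

lemma ms_integral_weak:
  assumes int: "has_ms_integral M F X" and Y: "square_integrable M Y"
    and h: "integrable lborel (\<lambda>\<tau>. LINT \<omega>|M. F \<tau> \<omega> * cnj (Y \<omega>))"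
  shows "(LINT \<omega>|M. X \<omega> * cnj (Y \<omega>)) = (LINT \<tau>|lborel. (LINT \<omega>|M. F \<tau> \<omega> * cnj (Y \<omega>)))"
    (is "?a = ?b")
proof -
  have F: "square_integrable M (F \<tau>)" for \<tau>
    using int by (simp add: has_ms_integral_def)
  have X: "square_integrable M X"
    using int by (simp add: has_ms_integral_def)
  obtain S where S: "\<And>n. ms_simple M (S n)"
    and lim1: "(\<lambda>n. \<integral>\<^sup>+\<tau>. ennreal (ms_norm M (\<lambda>\<omega>. F \<tau> \<omega> - S n \<tau> \<omega>)) \<partial>lborel) \<longlonglongrightarrow> 0"
    and lim2: "(\<lambda>n. ms_norm M (\<lambda>\<omega>. X \<omega> - (LINT \<tau>|lborel. S n \<tau> \<omega>))) \<longlonglongrightarrow> 0"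
    and fm: "\<And>n. (\<lambda>\<tau>. ms_norm M (\<lambda>\<omega>. F \<tau> \<omega> - S n \<tau> \<omega>)) \<in> borel_measurable lborel"
    using int unfolding has_ms_integral_def by blast
  define I where "I n = (\<integral>\<^sup>+\<tau>. ennreal (ms_norm M (\<lambda>\<omega>. F \<tau> \<omega> - S n \<tau> \<omega>)) \<partial>lborel)" for n
  define N where "N n = ms_norm M (\<lambda>\<omega>. X \<omega> - (LINT \<tau>|lborel. S n \<tau> \<omega>))" for n
  have "ennreal (cmod (?a - ?b)) \<le> ennreal (N n * ms_norm M Y) + ennreal (ms_norm M Y) * I n" for n
  proof -
    define V where "V = range (S n) - {\<lambda>_. 0}"
    define m where "m v = complex_of_real (measure lborel (S n -` {v}))" for v
    have sint: "(LINT \<tau>|lborel. S n \<tau> \<omega>) = (\<Sum>v\<in>V. m v * v \<omega>)" for \<omega>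
      using ms_simple_has_integral[OF S[of n], of "\<lambda>v. v \<omega>"]
      by (auto simp: V_def m_def dest: has_bochner_integral_integral_eq)
    have sqV: "square_integrable M v" if "v \<in> V" for v
      using ms_simple_level(4)[OF S[of n]] that by (simp add: V_def)
    have SI: "square_integrable M (\<lambda>\<omega>. LINT \<tau>|lborel. S n \<tau> \<omega>)"
      unfolding sint using sqV by (intro square_integrable_sum square_integrable_scale)
    have Sb: "has_bochner_integral lborel (\<lambda>\<tau>. LINT \<omega>|M. S n \<tau> \<omega> * cnj (Y \<omega>))
        (\<Sum>v\<in>V. m v * (LINT \<omega>|M. v \<omega> * cnj (Y \<omega>)))"
      using ms_simple_has_integral[OF S[of n], of "\<lambda>v. LINT \<omega>|M. v \<omega> * cnj (Y \<omega>)"]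
      by (simp add: V_def m_def)
    \<comment> \<open>The common value of the two orders of integration for the simple function; the
      claim follows by comparing each side with it.\<close>
    define bn where "bn = (\<Sum>v\<in>V. m v * (LINT \<omega>|M. v \<omega> * cnj (Y \<omega>)))"
    have Sbn: "(LINT \<omega>|M. (LINT \<tau>|lborel. S n \<tau> \<omega>) * cnj (Y \<omega>)) = bn"
    proof -
      have "(LINT \<omega>|M. (LINT \<tau>|lborel. S n \<tau> \<omega>) * cnj (Y \<omega>))
          = (LINT \<omega>|M. (\<Sum>v\<in>V. m v * (v \<omega> * cnj (Y \<omega>))))"
        by (simp add: sint sum_distrib_right mult.assoc)
      also have "\<dots> = (\<Sum>v\<in>V. LINT \<omega>|M. m v * (v \<omega> * cnj (Y \<omega>)))"
        by (intro Bochner_Integration.integral_sum integrable_mult_right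
            square_integrable_mult_cnj sqV Y)
      finally show ?thesis by (simp add: bn_def)
    qed
    have 1: "cmod (?a - bn) \<le> N n * ms_norm M Y"
    proof -
      have "?a - bn = (LINT \<omega>|M. (X \<omega> - (LINT \<tau>|lborel. S n \<tau> \<omega>)) * cnj (Y \<omega>))"
        unfolding Sbn[symmetric] left_diff_distrib
        by (intro Bochner_Integration.integral_diff[symmetric] square_integrable_mult_cnj X SI Y)
      then show ?thesis
        using ms_inner_le[OF square_integrable_diff[OF X SI] Y] by (simp add: N_def)
    qed
    have 2: "ennreal (cmod (?b - bn)) \<le> ennreal (ms_norm M Y) * I n"
    proof -
      have "?b - bn = (LINT \<tau>|lborel. (LINT \<omega>|M. F \<tau> \<omega> * cnj (Y \<omega>)) - (LINT \<omega>|M. S n \<tau> \<omega> * cnj (Y \<omega>)))"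
        using Sb h by (simp add: has_bochner_integral_iff bn_def)
      also have "ennreal (cmod \<dots>) \<le> (\<integral>\<^sup>+\<tau>. ennreal (cmod
          ((LINT \<omega>|M. F \<tau> \<omega> * cnj (Y \<omega>)) - (LINT \<omega>|M. S n \<tau> \<omega> * cnj (Y \<omega>)))) \<partial>lborel)"
        using Sb h by (intro integral_norm_bound_ennreal Bochner_Integration.integrable_diff)
          (auto simp: has_bochner_integral_iff)
      also have "\<dots> \<le> (\<integral>\<^sup>+\<tau>. ennreal (ms_norm M Y) * ennreal (ms_norm M (\<lambda>\<omega>. F \<tau> \<omega> - S n \<tau> \<omega>)) \<partial>lborel)"
      proof (rule nn_integral_mono)
        fix \<tau>
        have St: "square_integrable M (S n \<tau>)"
          using S[of n] by (simp add: ms_simple_def)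
        have "(LINT \<omega>|M. F \<tau> \<omega> * cnj (Y \<omega>)) - (LINT \<omega>|M. S n \<tau> \<omega> * cnj (Y \<omega>))
            = (LINT \<omega>|M. (F \<tau> \<omega> - S n \<tau> \<omega>) * cnj (Y \<omega>))"
          unfolding left_diff_distrib
          by (intro Bochner_Integration.integral_diff[symmetric] square_integrable_mult_cnj F St Y)
        also have "cmod \<dots> \<le> ms_norm M (\<lambda>\<omega>. F \<tau> \<omega> - S n \<tau> \<omega>) * ms_norm M Y"
          by (intro ms_inner_le square_integrable_diff F St Y)
        finally show "ennreal (cmod ((LINT \<omega>|M. F \<tau> \<omega> * cnj (Y \<omega>)) - (LINT \<omega>|M. S n \<tau> \<omega> * cnj (Y \<omega>))))
            \<le> ennreal (ms_norm M Y) * ennreal (ms_norm M (\<lambda>\<omega>. F \<tau> \<omega> - S n \<tau> \<omega>))"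
          by (simp add: ennreal_mult[symmetric] ms_norm_nonneg mult.commute ennreal_leI)
      qed
      also have "\<dots> = ennreal (ms_norm M Y) * I n"
        unfolding I_def using fm[of n] by (intro nn_integral_cmult) simp
      finally show ?thesis .
    qed
    have "cmod (?a - ?b) \<le> cmod (?a - bn) + cmod (?b - bn)"
      using norm_triangle_ineq4[of "?a - bn" "?b - bn"] by simp
    then have "ennreal (cmod (?a - ?b)) \<le> ennreal (cmod (?a - bn)) + ennreal (cmod (?b - bn))"
      by (simp flip: ennreal_plus add: ennreal_leI)
    also have "\<dots> \<le> ennreal (N n * ms_norm M Y) + ennreal (ms_norm M Y) * I n"
      using 1 2 by (intro add_mono ennreal_leI)
    finally show ?thesis .
  qed
  moreover have "(\<lambda>n. ennreal (N n * ms_norm M Y) + ennreal (ms_norm M Y) * I n)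
      \<longlonglongrightarrow> ennreal (0 * ms_norm M Y) + ennreal (ms_norm M Y) * 0"
    using lim1 lim2 by (intro tendsto_add tendsto_ennrealI tendsto_mult_right ennreal_tendsto_cmult)
      (simp_all add: I_def N_def)
  ultimately have "ennreal (cmod (?a - ?b)) \<le> ennreal (0 * ms_norm M Y) + ennreal (ms_norm M Y) * 0"
    by (intro LIMSEQ_le_const) auto
  then show ?thesis by simp
qed

lemma in_closed_span_diff:
  assumes "in_closed_span M \<Phi> X" "in_closed_span M \<Phi> Y" and \<Phi>: "\<And>t. square_integrable M (\<lambda>\<omega>. of_real (\<Phi> t \<omega>))"
  shows "in_closed_span M \<Phi> (\<lambda>\<omega>. X \<omega> - Y \<omega>)"
  unfolding in_closed_span_def
proof (intro conjI allI impI)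
  have X: "square_integrable M X" and Y: "square_integrable M Y"
    using assms by (auto simp: in_closed_span_def)
  show "square_integrable M (\<lambda>\<omega>. X \<omega> - Y \<omega>)"
    by (intro square_integrable_diff X Y)
  fix e :: real assume "e > 0"
  then have "e / 2 > 0" by simp
  from assms(1)[unfolded in_closed_span_def, THEN conjunct2, rule_format, OF this]
  obtain J c where J: "finite J" "ms_norm M (\<lambda>\<omega>. X \<omega> - (\<Sum>t\<in>J. c t * of_real (\<Phi> t \<omega>))) < e / 2"
    by blast
  from assms(2)[unfolded in_closed_span_def, THEN conjunct2, rule_format, OF \<open>e / 2 > 0\<close>]
  obtain K d where K: "finite K" "ms_norm M (\<lambda>\<omega>. Y \<omega> - (\<Sum>t\<in>K. d t * of_real (\<Phi> t \<omega>))) < e / 2"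
    by blast
  \<comment> \<open>The index sets may overlap, so both coefficient families are extended by zero to
    the union before they are subtracted.\<close>
  define b where "b t = (if t \<in> J then c t else 0) - (if t \<in> K then d t else 0)" for t
  have eq: "(\<Sum>t\<in>J \<union> K. b t * of_real (\<Phi> t \<omega>))
      = (\<Sum>t\<in>J. c t * of_real (\<Phi> t \<omega>)) - (\<Sum>t\<in>K. d t * of_real (\<Phi> t \<omega>))" for \<omega>
  proof -
    have "(\<Sum>t\<in>J \<union> K. b t * of_real (\<Phi> t \<omega>))
        = (\<Sum>t\<in>J \<union> K. if t \<in> J then c t * of_real (\<Phi> t \<omega>) else 0)
          - (\<Sum>t\<in>J \<union> K. if t \<in> K then d t * of_real (\<Phi> t \<omega>) else 0)"
      unfolding sum_subtractf[symmetric] by (intro sum.cong) (auto simp: b_def algebra_simps)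
    also have "(\<Sum>t\<in>J \<union> K. if t \<in> J then c t * of_real (\<Phi> t \<omega>) else 0)
        = (\<Sum>t\<in>J. c t * of_real (\<Phi> t \<omega>))"
      using J(1) K(1) by (intro sum.mono_neutral_cong_right) auto
    also have "(\<Sum>t\<in>J \<union> K. if t \<in> K then d t * of_real (\<Phi> t \<omega>) else 0)
        = (\<Sum>t\<in>K. d t * of_real (\<Phi> t \<omega>))"
      using J(1) K(1) by (intro sum.mono_neutral_cong_right) auto
    finally show ?thesis .
  qed
  define P where "P = (\<lambda>\<omega>. X \<omega> - (\<Sum>t\<in>J. c t * of_real (\<Phi> t \<omega>)))"
  define Q where "Q = (\<lambda>\<omega>. Y \<omega> - (\<Sum>t\<in>K. d t * of_real (\<Phi> t \<omega>)))"
  have sq: "square_integrable M P" "square_integrable M Q"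
    unfolding P_def Q_def
    by (intro square_integrable_diff X Y square_integrable_sum square_integrable_scale \<Phi>)+
  have "ms_norm M (\<lambda>\<omega>. P \<omega> - Q \<omega>) \<le> ms_norm M P + ms_norm M Q"
    using ms_norm_triangle_diff[OF sq(1) square_integrable_zero sq(2)]
    using ms_norm_minus[of M "\<lambda>_. 0" Q] by (simp add: ms_norm_def)
  also have "\<dots> < e"
    using J K by (simp add: P_def Q_def)
  also have "(\<lambda>\<omega>. P \<omega> - Q \<omega>) = (\<lambda>\<omega>. (X \<omega> - Y \<omega>) - (\<Sum>t\<in>J \<union> K. b t * of_real (\<Phi> t \<omega>)))"
    by (simp add: P_def Q_def eq fun_eq_iff)
  finally show "\<exists>J c. finite J \<and> ms_norm M (\<lambda>\<omega>. X \<omega> - Y \<omega> - (\<Sum>t\<in>J. c t * of_real (\<Phi> t \<omega>))) < e"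
    using J K by (intro exI[of _ "J \<union> K"] exI[of _ b]) simp
qed

text \<open>The kernel has modulus one, so integrability on the plane reduces to that of the two
  factors. This moves the Fourier transform from the covariance onto the weight.\<close>

lemma fourier_fubini:
  fixes f h :: "real \<Rightarrow> complex"
  assumes f: "integrable lborel f" and h: "integrable lborel h"
  shows "(LINT \<tau>|lborel. f \<tau> * (LINT l|lborel. exp (\<i> * of_real (\<tau> * l)) * h l))
    = (LINT l|lborel. (LINT \<tau>|lborel. f \<tau> * exp (\<i> * of_real (\<tau> * l))) * h l)"
proof -
  have [measurable]: "f \<in> borel_measurable borel" "h \<in> borel_measurable borel"
    using f h by auto
  have int: "integrable (lborel \<Otimes>\<^sub>M lborel) (case_prod (\<lambda>l \<tau>. f \<tau> * exp (\<i> * of_real (\<tau> * l)) * h l))"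
  proof (rule lborel_pair.Fubini_integrable)
    show "integrable lborel (\<lambda>x. LINT y|lborel. norm (case (x, y) of (l, \<tau>) \<Rightarrow> f \<tau> * exp (\<i> * of_real (\<tau> * l)) * h l))"
      using h by (simp add: norm_mult)
    show "AE x in lborel. integrable lborel (\<lambda>y. case (x, y) of (l, \<tau>) \<Rightarrow> f \<tau> * exp (\<i> * of_real (\<tau> * l)) * h l)"
    proof (rule AE_I2)
      fix l
      have "integrable lborel (\<lambda>\<tau>. f \<tau> * exp (\<i> * of_real (\<tau> * l)))"
        by (rule Bochner_Integration.integrable_bound[OF f]) (auto simp: norm_mult)
      then show "integrable lborel (\<lambda>y. case (l, y) of (l, \<tau>) \<Rightarrow> f \<tau> * exp (\<i> * of_real (\<tau> * l)) * h l)"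
        by simp
    qed
  qed measurable
  have "(LINT \<tau>|lborel. f \<tau> * (LINT l|lborel. exp (\<i> * of_real (\<tau> * l)) * h l))
      = (LINT \<tau>|lborel. (LINT l|lborel. f \<tau> * exp (\<i> * of_real (\<tau> * l)) * h l))"
    by (simp add: mult.assoc)
  also have "\<dots> = (LINT l|lborel. (LINT \<tau>|lborel. f \<tau> * exp (\<i> * of_real (\<tau> * l)) * h l))"
    by (rule lborel_pair.Fubini_integral[OF int])
  finally show ?thesis by simp
qed

text \<open>Stationarity is an equality of laws; this is how it becomes an equality of
  moments.\<close>

lemma distr_integral_eq:
  assumes "distr M N X = distr M N Y" "X \<in> measurable M N" "Y \<in> measurable M N"
    "f \<in> borel_measurable N"
  shows "(LINT x|M. (f (X x) :: real)) = (LINT x|M. f (Y x))"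
  using integral_distr[OF assms(2,4)] integral_distr[OF assms(3,4)] assms(1) by simp

section \<open>Weighted integrals of a stationary process\<close>

locale spectral_process = prob_space M for M :: "'w measure" +
  fixes \<Phi> :: "real \<Rightarrow> 'w \<Rightarrow> real" and p :: "real \<Rightarrow> real"
  assumes gaussian: "gaussian_process M \<Phi>"
    and stationary: "stationary_process M \<Phi>"
    and continuous: "ms_continuous M \<Phi>"
    and spectral: "has_spectral_density M \<Phi> p"
begin

lemma process_measurable [measurable]: "\<Phi> t \<in> borel_measurable M"
  using gaussian by (simp add: gaussian_process_def)

lemma process_square_integrable: "square_integrable M (\<lambda>\<omega>. of_real (\<Phi> t \<omega>))"
  using continuous by (simp add: square_integrable_def ms_continuous_def)

lemma process_integrable: "integrable M (\<Phi> t)"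
  using ms_integrable[OF process_square_integrable[of t]]
  by (simp add: complex_of_real_integrable_eq)

lemma process_product_integrable: "integrable M (\<lambda>\<omega>. \<Phi> s \<omega> * \<Phi> t \<omega>)"
  using square_integrable_mult_cnj[OF process_square_integrable[of s] process_square_integrable[of t]]
  by (simp add: complex_of_real_integrable_eq flip: of_real_mult)

lemma process_mean: "expectation (\<Phi> t) = expectation (\<Phi> 0)"
proof -
  have stat: "distr M (\<Pi>\<^sub>M r\<in>{0}. borel) (\<lambda>\<omega>. \<lambda>r\<in>{0}. \<Phi> (r + t) \<omega>)
      = distr M (\<Pi>\<^sub>M r\<in>{0}. borel) (\<lambda>\<omega>. \<lambda>r\<in>{0}. \<Phi> r \<omega>)"
    using stationary unfolding stationary_process_def by blast
  have "expectation (\<lambda>\<omega>. (\<lambda>r\<in>{0}. \<Phi> (r + t) \<omega>) 0) = expectation (\<lambda>\<omega>. (\<lambda>r\<in>{0}. \<Phi> r \<omega>) 0)"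
    by (intro distr_integral_eq[where N = "\<Pi>\<^sub>M r\<in>{0::real}. borel" and f = "\<lambda>x. x 0"]
        measurable_component_singleton measurable_restrict stat) auto
  then show ?thesis by simp
qed

text \<open>The process may have a nonzero mean, which leaves a constant beside the covariance. That
  constant disappears later against weights of integral zero.\<close>

lemma process_second_moment:
  "expectation (\<lambda>\<omega>. \<Phi> s \<omega> * \<Phi> t \<omega>) = covariance M (\<Phi> (s - t)) (\<Phi> 0) + (expectation (\<Phi> 0))\<^sup>2"
proof -
  \<comment> \<open>For \<open>s = t\<close> this is a singleton; working with the membership facts
    alone covers both cases.\<close>
  define J where "J = {s - t, 0}"
  have J: "finite J" "s - t \<in> J" "0 \<in> J"
    by (simp_all add: J_def)
  have stat: "distr M (\<Pi>\<^sub>M r\<in>J. borel) (\<lambda>\<omega>. \<lambda>r\<in>J. \<Phi> (r + t) \<omega>)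
      = distr M (\<Pi>\<^sub>M r\<in>J. borel) (\<lambda>\<omega>. \<lambda>r\<in>J. \<Phi> r \<omega>)"
    using stationary J(1) unfolding stationary_process_def by blast
  have "expectation (\<lambda>\<omega>. (\<lambda>r\<in>J. \<Phi> (r + t) \<omega>) (s - t) * (\<lambda>r\<in>J. \<Phi> (r + t) \<omega>) 0)
      = expectation (\<lambda>\<omega>. (\<lambda>r\<in>J. \<Phi> r \<omega>) (s - t) * (\<lambda>r\<in>J. \<Phi> r \<omega>) 0)"
    using J
    by (intro distr_integral_eq[where N = "\<Pi>\<^sub>M r\<in>J. borel" and f = "\<lambda>x. x (s - t) * x 0"]
        borel_measurable_times measurable_component_singleton measurable_restrict stat) auto
  then have "expectation (\<lambda>\<omega>. \<Phi> s \<omega> * \<Phi> t \<omega>) = expectation (\<lambda>\<omega>. \<Phi> (s - t) \<omega> * \<Phi> 0 \<omega>)"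
    using J by simp
  moreover have "covariance M (\<Phi> (s - t)) (\<Phi> 0)
      = expectation (\<lambda>\<omega>. \<Phi> (s - t) \<omega> * \<Phi> 0 \<omega>) - (expectation (\<Phi> 0))\<^sup>2"
    using process_product_integrable[of "s - t" 0] process_integrable
    by (simp add: covariance_def process_mean[of "s - t"] algebra_simps prob_space power2_eq_square)
  ultimately show ?thesis by simp
qed

lemma process_spectral_moment:
  "complex_of_real (expectation (\<lambda>\<omega>. \<Phi> s \<omega> * \<Phi> t \<omega>))
    = (LINT l|lborel. exp (\<i> * of_real ((s - t) * l)) * of_real (p l))
      + of_real ((expectation (\<Phi> 0))\<^sup>2)"
  using spectral by (simp add: process_second_moment has_spectral_density_def)

lemma process_ms_norm: "ms_norm M (\<lambda>\<omega>. of_real (\<Phi> t \<omega>)) = ms_norm M (\<lambda>\<omega>. of_real (\<Phi> 0 \<omega>))"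
  using process_second_moment[of t t] process_second_moment[of 0 0]
  by (simp add: ms_norm_def power2_eq_square)

text \<open>Mean-square continuity enters here: it makes pairings measurable in time, although
  nothing is known about sample paths of \<open>\<Phi>\<close>.\<close>

lemma process_inner_continuous:
  assumes Y: "square_integrable M Y"
  shows "continuous_on UNIV (\<lambda>t. LINT \<omega>|M. of_real (\<Phi> t \<omega>) * cnj (Y \<omega>))"
proof (rule continuous_at_imp_continuous_on, rule ballI)
  fix t
  have sq: "square_integrable M (\<lambda>\<omega>. of_real (\<Phi> u \<omega>) - of_real (\<Phi> t \<omega>))" for u
    by (intro square_integrable_diff process_square_integrable)
  have "((\<lambda>u. sqrt (LINT \<omega>|M. (\<Phi> u \<omega> - \<Phi> t \<omega>)\<^sup>2) * ms_norm M Y) \<longlongrightarrow> sqrt 0 * ms_norm M Y) (at t)"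
    using continuous by (intro tendsto_intros) (simp add: ms_continuous_def)
  then have lim: "((\<lambda>u. sqrt (LINT \<omega>|M. (\<Phi> u \<omega> - \<Phi> t \<omega>)\<^sup>2) * ms_norm M Y) \<longlongrightarrow> 0) (at t)"
    by simp
  have "((\<lambda>u. (LINT \<omega>|M. of_real (\<Phi> u \<omega>) * cnj (Y \<omega>)) - (LINT \<omega>|M. of_real (\<Phi> t \<omega>) * cnj (Y \<omega>))) \<longlongrightarrow> 0) (at t)"
  proof (rule Lim_null_comparison[OF always_eventually lim], intro allI)
    fix u
    have "(LINT \<omega>|M. of_real (\<Phi> u \<omega>) * cnj (Y \<omega>)) - (LINT \<omega>|M. of_real (\<Phi> t \<omega>) * cnj (Y \<omega>))
      = (LINT \<omega>|M. (of_real (\<Phi> u \<omega>) - of_real (\<Phi> t \<omega>)) * cnj (Y \<omega>))"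
      unfolding left_diff_distrib
      by (intro Bochner_Integration.integral_diff[symmetric] square_integrable_mult_cnj
          process_square_integrable Y)
    also have "cmod \<dots> \<le> ms_norm M (\<lambda>\<omega>. of_real (\<Phi> u \<omega>) - of_real (\<Phi> t \<omega>)) * ms_norm M Y"
      by (intro ms_inner_le sq Y)
    also have "ms_norm M (\<lambda>\<omega>. of_real (\<Phi> u \<omega>) - of_real (\<Phi> t \<omega>)) = sqrt (LINT \<omega>|M. (\<Phi> u \<omega> - \<Phi> t \<omega>)\<^sup>2)"
      by (simp add: ms_norm_def flip: of_real_diff)
    finally show "cmod ((LINT \<omega>|M. of_real (\<Phi> u \<omega>) * cnj (Y \<omega>)) - (LINT \<omega>|M. of_real (\<Phi> t \<omega>) * cnj (Y \<omega>)))
      \<le> sqrt (LINT \<omega>|M. (\<Phi> u \<omega> - \<Phi> t \<omega>)\<^sup>2) * ms_norm M Y" .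
  qed
  then show "isCont (\<lambda>t. LINT \<omega>|M. of_real (\<Phi> t \<omega>) * cnj (Y \<omega>)) t"
    unfolding isCont_def by (rule LIM_zero_cancel)
qed

text \<open>By stationarity the norm of \<open>\<Phi> \<tau>\<close> does not depend on
  \<open>\<tau>\<close>, so the pairing is bounded and the integrability of \<open>g\<close>
  suffices.\<close>

lemma weight_inner_integrable:
  assumes g: "integrable lborel g" and Y: "square_integrable M Y"
  shows "integrable lborel (\<lambda>\<tau>. g \<tau> * (LINT \<omega>|M. of_real (\<Phi> \<tau> \<omega>) * cnj (Y \<omega>)))"
proof (rule Bochner_Integration.integrable_bound)
  define b where "b = ms_norm M (\<lambda>\<omega>. of_real (\<Phi> 0 \<omega>)) * ms_norm M Y"
  show "integrable lborel (\<lambda>\<tau>. of_real b * g \<tau>)"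
    using g by simp
  have [measurable]: "g \<in> borel_measurable borel"
    using g by simp
  have [measurable]: "(\<lambda>t. LINT \<omega>|M. of_real (\<Phi> t \<omega>) * cnj (Y \<omega>)) \<in> borel_measurable borel"
    by (intro borel_measurable_continuous_onI process_inner_continuous Y)
  show "(\<lambda>\<tau>. g \<tau> * (LINT \<omega>|M. of_real (\<Phi> \<tau> \<omega>) * cnj (Y \<omega>))) \<in> borel_measurable lborel"
    by measurable
  have "cmod (LINT \<omega>|M. of_real (\<Phi> \<tau> \<omega>) * cnj (Y \<omega>)) \<le> b" for \<tau>
    using ms_inner_le[OF process_square_integrable[of \<tau>] Y] by (simp add: b_def process_ms_norm[of \<tau>])
  then have "cmod (LINT \<omega>|M. of_real (\<Phi> \<tau> \<omega>) * cnj (Y \<omega>)) \<le> \<bar>b\<bar>" for \<tau>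
    by (rule order.trans) (rule abs_ge_self)
  then show "AE \<tau> in lborel. cmod (g \<tau> * (LINT \<omega>|M. of_real (\<Phi> \<tau> \<omega>) * cnj (Y \<omega>))) \<le> cmod (of_real b * g \<tau>)"
    unfolding norm_mult norm_of_real mult.commute[of "cmod (g _)"]
    by (intro AE_I2 mult_right_mono) simp_all
qed

text \<open>The mean-square integral of \<open>\<Phi> \<tau> * g \<tau>\<close> in weak form: unlike \<^const>\<open>has_ms_integral\<close>,
  this passes to differences without a measurability condition on the approximation error.\<close>

definition weighted_integral :: "(real \<Rightarrow> complex) \<Rightarrow> ('w \<Rightarrow> complex) \<Rightarrow> bool" where
  "weighted_integral g X \<longleftrightarrow> integrable lborel g \<and> (LINT \<tau>|lborel. g \<tau>) = 0 \<and> in_closed_span M \<Phi> X \<and>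
     (\<forall>Y. square_integrable M Y \<longrightarrow> (LINT \<omega>|M. X \<omega> * cnj (Y \<omega>))
        = (LINT \<tau>|lborel. g \<tau> * (LINT \<omega>|M. of_real (\<Phi> \<tau> \<omega>) * cnj (Y \<omega>))))"

lemma weighted_integralI:
  assumes "has_ms_integral M (\<lambda>\<tau> \<omega>. of_real (\<Phi> \<tau> \<omega>) * g \<tau>) X"
    and g: "integrable lborel g" "(LINT \<tau>|lborel. g \<tau>) = 0"
  shows "weighted_integral g X"
  unfolding weighted_integral_def
proof (intro conjI allI impI g ms_integral_in_closed_span[OF assms(1)])
  fix Y :: "'w \<Rightarrow> complex" assume Y: "square_integrable M Y"
  have eq: "(LINT \<omega>|M. of_real (\<Phi> \<tau> \<omega>) * g \<tau> * cnj (Y \<omega>))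
      = g \<tau> * (LINT \<omega>|M. of_real (\<Phi> \<tau> \<omega>) * cnj (Y \<omega>))" for \<tau>
    by (subst integral_mult_right_zero[symmetric]) (simp add: mult_ac)
  show "(LINT \<omega>|M. X \<omega> * cnj (Y \<omega>))
      = (LINT \<tau>|lborel. g \<tau> * (LINT \<omega>|M. of_real (\<Phi> \<tau> \<omega>) * cnj (Y \<omega>)))"
    using ms_integral_weak[OF assms(1) Y] weight_inner_integrable[OF g(1) Y] by (simp add: eq)
qed

lemma weighted_integral_zero: "weighted_integral (\<lambda>_. 0) (\<lambda>_. 0)"
proof -
  have "in_closed_span M \<Phi> (\<lambda>_. 0)"
    unfolding in_closed_span_def
  proof (intro conjI allI impI square_integrable_zero)
    fix e :: real assume "e > 0"
    then show "\<exists>J c. finite J \<and> ms_norm M (\<lambda>\<omega>. 0 - (\<Sum>t\<in>J. c t * of_real (\<Phi> t \<omega>))) < e"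
      by (intro exI[of _ "{}"] exI[of _ "\<lambda>_. 0"]) (simp add: ms_norm_def)
  qed
  then show ?thesis
    by (simp add: weighted_integral_def)
qed

lemma weighted_integralD:
  assumes "weighted_integral g X"
  shows "integrable lborel g" "(LINT \<tau>|lborel. g \<tau>) = 0" "in_closed_span M \<Phi> X"
    "square_integrable M X"
    "square_integrable M Y \<Longrightarrow> (LINT \<omega>|M. X \<omega> * cnj (Y \<omega>))
        = (LINT \<tau>|lborel. g \<tau> * (LINT \<omega>|M. of_real (\<Phi> \<tau> \<omega>) * cnj (Y \<omega>)))"
proof -
  note W = assms[unfolded weighted_integral_def]
  show "integrable lborel g" by (rule W[THEN conjunct1])
  show "(LINT \<tau>|lborel. g \<tau>) = 0" by (rule W[THEN conjunct2, THEN conjunct1])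
  show X: "in_closed_span M \<Phi> X" by (rule W[THEN conjunct2, THEN conjunct2, THEN conjunct1])
  show "square_integrable M X" using X by (simp add: in_closed_span_def)
  show "(LINT \<omega>|M. X \<omega> * cnj (Y \<omega>))
      = (LINT \<tau>|lborel. g \<tau> * (LINT \<omega>|M. of_real (\<Phi> \<tau> \<omega>) * cnj (Y \<omega>)))"
    if "square_integrable M Y"
    using W[THEN conjunct2, THEN conjunct2, THEN conjunct2, rule_format, OF that] .
qed

lemma weighted_integral_diff:
  assumes "weighted_integral g X" "weighted_integral h Y"
  shows "weighted_integral (\<lambda>\<tau>. g \<tau> - h \<tau>) (\<lambda>\<omega>. X \<omega> - Y \<omega>)"
  unfolding weighted_integral_def
proof (intro conjI allI impI)
  have g: "integrable lborel g" "(LINT \<tau>|lborel. g \<tau>) = 0" "in_closed_span M \<Phi> X"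
    and h: "integrable lborel h" "(LINT \<tau>|lborel. h \<tau>) = 0" "in_closed_span M \<Phi> Y"
    by (rule weighted_integralD[OF assms(1)] weighted_integralD[OF assms(2)])+
  have sq: "square_integrable M X" "square_integrable M Y"
    by (rule weighted_integralD[OF assms(1)] weighted_integralD[OF assms(2)])+
  show "integrable lborel (\<lambda>\<tau>. g \<tau> - h \<tau>)" "(LINT \<tau>|lborel. g \<tau> - h \<tau>) = 0"
    using g h by simp_all
  show "in_closed_span M \<Phi> (\<lambda>\<omega>. X \<omega> - Y \<omega>)"
    by (intro in_closed_span_diff process_square_integrable g h)
  fix Z :: "'w \<Rightarrow> complex" assume Z: "square_integrable M Z"
  have "(LINT \<omega>|M. (X \<omega> - Y \<omega>) * cnj (Z \<omega>)) = (LINT \<omega>|M. X \<omega> * cnj (Z \<omega>)) - (LINT \<omega>|M. Y \<omega> * cnj (Z \<omega>))"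
    unfolding left_diff_distrib
    by (intro Bochner_Integration.integral_diff square_integrable_mult_cnj sq Z)
  also have "(LINT \<omega>|M. X \<omega> * cnj (Z \<omega>))
      = (LINT \<tau>|lborel. g \<tau> * (LINT \<omega>|M. of_real (\<Phi> \<tau> \<omega>) * cnj (Z \<omega>)))"
    by (rule weighted_integralD(5)[OF assms(1) Z])
  also have "(LINT \<omega>|M. Y \<omega> * cnj (Z \<omega>))
      = (LINT \<tau>|lborel. h \<tau> * (LINT \<omega>|M. of_real (\<Phi> \<tau> \<omega>) * cnj (Z \<omega>)))"
    by (rule weighted_integralD(5)[OF assms(2) Z])
  also have "(LINT \<tau>|lborel. g \<tau> * (LINT \<omega>|M. of_real (\<Phi> \<tau> \<omega>) * cnj (Z \<omega>)))
        - (LINT \<tau>|lborel. h \<tau> * (LINT \<omega>|M. of_real (\<Phi> \<tau> \<omega>) * cnj (Z \<omega>)))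
      = (LINT \<tau>|lborel. (g \<tau> - h \<tau>) * (LINT \<omega>|M. of_real (\<Phi> \<tau> \<omega>) * cnj (Z \<omega>)))"
    unfolding left_diff_distrib
    by (rule Bochner_Integration.integral_diff[symmetric, OF weight_inner_integrable[OF g(1) Z]
        weight_inner_integrable[OF h(1) Z]])
  finally show "(LINT \<omega>|M. (X \<omega> - Y \<omega>) * cnj (Z \<omega>))
      = (LINT \<tau>|lborel. (g \<tau> - h \<tau>) * (LINT \<omega>|M. of_real (\<Phi> \<tau> \<omega>) * cnj (Z \<omega>)))" .
qed

text \<open>Pair with the constant 1: the mean of the process is constant in time and comes out of
  an integral of \<open>g\<close>, which is zero.\<close>

lemma weighted_integral_mean:
  assumes "weighted_integral g X"
  shows "expectation X = 0"
proof -
  have *: "(LINT \<omega>|M. complex_of_real (\<Phi> \<tau> \<omega>) * cnj 1) = of_real (expectation (\<Phi> 0))" for \<tau>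
    using arg_cong[OF process_mean[of \<tau>], of complex_of_real] by simp
  have "(LINT \<omega>|M. X \<omega> * cnj 1) = (LINT \<tau>|lborel. g \<tau> * (LINT \<omega>|M. complex_of_real (\<Phi> \<tau> \<omega>) * cnj 1))"
    by (rule weighted_integralD(5)[OF assms square_integrable_const[of 1]])
  also have "\<dots> = (LINT \<tau>|lborel. g \<tau> * of_real (expectation (\<Phi> 0)))"
    unfolding * ..
  also have "\<dots> = 0"
    using weighted_integralD(2)[OF assms] by simp
  finally show ?thesis
    by simp
qed

text \<open>The spectral isometry, obtained from covariances alone instead of a random spectral
  measure. The weak identity is used twice: paired with \<open>\<Phi> t\<close> it expresses inner
  products through the density, and paired with \<open>X\<close> itself it reduces the second moment
  to those inner products.\<close>

lemma weighted_integral_isometry: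
  assumes X: "weighted_integral g X"
  shows "expectation (\<lambda>\<omega>. (cmod (X \<omega>))\<^sup>2)
    = (LINT l|lborel. (cmod (LINT \<tau>|lborel. g \<tau> * exp (\<i> * of_real (\<tau> * l))))\<^sup>2 * p l)"
proof -
  define G where "G l = (LINT \<tau>|lborel. g \<tau> * exp (\<i> * of_real (\<tau> * l)))" for l
  have g: "integrable lborel g" and g0: "(LINT \<tau>|lborel. g \<tau>) = 0" and sq: "square_integrable M X"
    by (rule weighted_integralD[OF X])+
  have p: "integrable lborel p"
    using spectral by (simp add: has_spectral_density_def)
  have [measurable]: "g \<in> borel_measurable borel" "p \<in> borel_measurable borel"
    using g p by auto
  have [measurable]: "G \<in> borel_measurable borel"
    unfolding G_def by measurable
  have Gb: "cmod (G l) \<le> (LINT \<tau>|lborel. cmod (g \<tau>))" for l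
    using integral_norm_bound[of lborel "\<lambda>\<tau>. g \<tau> * exp (\<i> * of_real (\<tau> * l))"]
    by (simp add: G_def norm_mult)
  have inner: "(LINT \<omega>|M. X \<omega> * of_real (\<Phi> t \<omega>))
      = (LINT l|lborel. exp (- (\<i> * of_real (t * l))) * (of_real (p l) * G l))" for t
  proof -
    define f where "f l = exp (- (\<i> * of_real (t * l))) * complex_of_real (p l)" for l
    have [measurable]: "f \<in> borel_measurable borel"
      unfolding f_def by measurable
    have f: "integrable lborel f"
      by (rule Bochner_Integration.integrable_bound[OF p]) (auto simp: norm_mult f_def)
    have "(LINT \<omega>|M. X \<omega> * of_real (\<Phi> t \<omega>))
        = (LINT \<tau>|lborel. g \<tau> * (LINT \<omega>|M. of_real (\<Phi> \<tau> \<omega>) * of_real (\<Phi> t \<omega>)))"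
    proof -
      have "(LINT \<omega>|M. X \<omega> * cnj (of_real (\<Phi> t \<omega>)))
          = (LINT \<tau>|lborel. g \<tau> * (LINT \<omega>|M. of_real (\<Phi> \<tau> \<omega>) * cnj (of_real (\<Phi> t \<omega>))))"
        by (rule weighted_integralD(5)[OF X process_square_integrable[of t]])
      then show ?thesis
        unfolding complex_cnj_complex_of_real .
    qed
    also have "\<dots> = (LINT \<tau>|lborel. g \<tau> * (LINT l|lborel. exp (\<i> * of_real (\<tau> * l)) * f l)
        + g \<tau> * of_real ((expectation (\<Phi> 0))\<^sup>2))"
    proof (rule Bochner_Integration.integral_cong[OF refl])
      fix \<tau>
      have e: "exp (\<i> * of_real ((\<tau> - t) * l)) * of_real (p l) = exp (\<i> * of_real (\<tau> * l)) * f l" for l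
        by (simp add: f_def left_diff_distrib right_diff_distrib mult_exp_exp)
      have "(LINT \<omega>|M. complex_of_real (\<Phi> \<tau> \<omega>) * of_real (\<Phi> t \<omega>))
          = of_real (expectation (\<lambda>\<omega>. \<Phi> \<tau> \<omega> * \<Phi> t \<omega>))"
        unfolding of_real_mult[symmetric] by (rule integral_complex_of_real)
      also have "\<dots> = (LINT l|lborel. exp (\<i> * of_real (\<tau> * l)) * f l) + of_real ((expectation (\<Phi> 0))\<^sup>2)"
        unfolding process_spectral_moment e ..
      finally show "g \<tau> * (LINT \<omega>|M. of_real (\<Phi> \<tau> \<omega>) * of_real (\<Phi> t \<omega>))
          = g \<tau> * (LINT l|lborel. exp (\<i> * of_real (\<tau> * l)) * f l)
            + g \<tau> * of_real ((expectation (\<Phi> 0))\<^sup>2)"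
        by (simp only: distrib_left)
    qed
    \<comment> \<open>The mean of the process contributes a constant multiple of the integral of
      \<open>g\<close>, hence nothing.\<close>
    also have "\<dots> = (LINT \<tau>|lborel. g \<tau> * (LINT l|lborel. exp (\<i> * of_real (\<tau> * l)) * f l))"
    proof (subst Bochner_Integration.integral_add)
      show "integrable lborel (\<lambda>\<tau>. g \<tau> * (LINT l|lborel. exp (\<i> * of_real (\<tau> * l)) * f l))"
      proof (rule Bochner_Integration.integrable_bound)
        show "(\<lambda>\<tau>. g \<tau> * (LINT l|lborel. exp (\<i> * of_real (\<tau> * l)) * f l)) \<in> borel_measurable lborel"
          by measurable
        show "integrable lborel (\<lambda>\<tau>. of_real (LINT l|lborel. cmod (f l)) * g \<tau>)"
          using g by simp
        have "cmod (LINT l|lborel. exp (\<i> * of_real (\<tau> * l)) * f l) \<le> (LINT l|lborel. cmod (f l))" for \<tau>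
          using integral_norm_bound[of lborel "\<lambda>l. exp (\<i> * of_real (\<tau> * l)) * f l"]
          by (simp add: norm_mult)
        then have "cmod (LINT l|lborel. exp (\<i> * of_real (\<tau> * l)) * f l) \<le> \<bar>LINT l|lborel. cmod (f l)\<bar>" for \<tau>
          by (rule order.trans) (rule abs_ge_self)
        then show "AE \<tau> in lborel. cmod (g \<tau> * (LINT l|lborel. exp (\<i> * of_real (\<tau> * l)) * f l))
            \<le> cmod (of_real (LINT l|lborel. cmod (f l)) * g \<tau>)"
          unfolding norm_mult norm_of_real mult.commute[of "cmod (g _)"]
          by (intro AE_I2 mult_right_mono) simp_all
      qed
    qed (use g g0 in simp_all)
    also have "\<dots> = (LINT l|lborel. G l * f l)"
      unfolding G_def by (rule fourier_fubini[OF g f])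
    finally show ?thesis
      by (simp add: f_def mult_ac)
  qed
  \<comment> \<open>Conjugating the formula for inner products restores the kernel with positive
    sign and leaves these factors, so the same exchange applies again and produces
    \<open>G l * h l\<close>, which is \<open>(cmod (G l))\<^sup>2 * p l\<close>.\<close>
  define h where "h l = of_real (p l) * cnj (G l)" for l
  have h: "integrable lborel h"
  proof (rule Bochner_Integration.integrable_bound)
    show "integrable lborel (\<lambda>l. (LINT \<tau>|lborel. cmod (g \<tau>)) * p l)"
      using p by simp
    have "(\<lambda>l. cnj (G l)) \<in> borel_measurable borel"
      by (rule borel_measurable_continuous_on[where f = cnj]) (auto intro!: continuous_intros)
    then show "h \<in> borel_measurable lborel"
      unfolding h_def by simp
    show "AE l in lborel. cmod (h l) \<le> norm ((LINT \<tau>|lborel. cmod (g \<tau>)) * p l)"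
    proof (rule AE_I2)
      fix l
      have "\<bar>p l\<bar> * cmod (G l) \<le> \<bar>p l\<bar> * (LINT \<tau>|lborel. cmod (g \<tau>))"
        by (rule mult_left_mono[OF Gb]) simp
      then show "cmod (h l) \<le> norm ((LINT \<tau>|lborel. cmod (g \<tau>)) * p l)"
        by (simp add: h_def norm_mult abs_mult mult.commute)
    qed
  qed
  have "complex_of_real (expectation (\<lambda>\<omega>. (cmod (X \<omega>))\<^sup>2))
      = (LINT \<omega>|M. complex_of_real ((cmod (X \<omega>))\<^sup>2))"
    by (rule integral_complex_of_real[symmetric])
  also have "\<dots> = (LINT \<omega>|M. X \<omega> * cnj (X \<omega>))"
    unfolding complex_norm_square ..
  also have "\<dots> = (LINT \<tau>|lborel. g \<tau> * (LINT \<omega>|M. of_real (\<Phi> \<tau> \<omega>) * cnj (X \<omega>)))"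
    by (rule weighted_integralD(5)[OF X sq])
  also have "\<dots> = (LINT \<tau>|lborel. g \<tau> * (LINT l|lborel. exp (\<i> * of_real (\<tau> * l)) * h l))"
  proof (rule Bochner_Integration.integral_cong[OF refl])
    fix \<tau>
    have "(LINT \<omega>|M. of_real (\<Phi> \<tau> \<omega>) * cnj (X \<omega>)) = (LINT \<omega>|M. cnj (X \<omega> * of_real (\<Phi> \<tau> \<omega>)))"
      by (simp only: complex_cnj_mult complex_cnj_complex_of_real mult.commute)
    also have "\<dots> = cnj (LINT l|lborel. exp (- (\<i> * of_real (\<tau> * l))) * (of_real (p l) * G l))"
      by (subst Bochner_Integration.integral_cnj) (simp only: inner)
    also have "\<dots> = (LINT l|lborel. cnj (exp (- (\<i> * of_real (\<tau> * l))) * (of_real (p l) * G l)))"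
      by (rule Bochner_Integration.integral_cnj[symmetric])
    also have "\<dots> = (LINT l|lborel. exp (\<i> * of_real (\<tau> * l)) * h l)"
      by (simp add: h_def exp_cnj)
    finally show "g \<tau> * (LINT \<omega>|M. of_real (\<Phi> \<tau> \<omega>) * cnj (X \<omega>))
        = g \<tau> * (LINT l|lborel. exp (\<i> * of_real (\<tau> * l)) * h l)" by simp
  qed
  also have "\<dots> = (LINT l|lborel. G l * h l)"
    unfolding G_def by (rule fourier_fubini[OF g h])
  also have "\<dots> = (LINT l|lborel. complex_of_real ((cmod (G l))\<^sup>2 * p l))"
  proof (rule Bochner_Integration.integral_cong[OF refl])
    fix l
    have "complex_of_real ((cmod (G l))\<^sup>2 * p l) = (G l * cnj (G l)) * of_real (p l)"
      by (simp only: of_real_mult complex_norm_square)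
    then show "G l * h l = complex_of_real ((cmod (G l))\<^sup>2 * p l)"
      by (simp only: h_def mult_ac)
  qed
  also have "\<dots> = of_real (LINT l|lborel. (cmod (G l))\<^sup>2 * p l)"
    by (rule integral_complex_of_real)
  finally show ?thesis
    by (simp only: of_real_eq_iff G_def)
qed

end

section \<open>Exponential moments\<close>

text \<open>Completing the square: tilting a normal density by an exponential gives a normal density
  with mean shifted by \<open>\<theta> * \<sigma>\<^sup>2\<close>, up to a constant factor.\<close>

lemma (in prob_space) normal_distributed_mgf:
  assumes "\<sigma> > 0" and D: "distributed M lborel X (normal_density \<mu> \<sigma>)"
  shows "(\<integral>\<^sup>+\<omega>. ennreal (exp (\<theta> * X \<omega>)) \<partial>M) = ennreal (exp (\<theta> * \<mu> + \<theta>\<^sup>2 * \<sigma>\<^sup>2 / 2))"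
proof -
  let ?C = "exp (\<theta> * \<mu> + \<theta>\<^sup>2 * \<sigma>\<^sup>2 / 2)"
  have eq: "normal_density \<mu> \<sigma> x * exp (\<theta> * x) = ?C * normal_density (\<mu> + \<theta> * \<sigma>\<^sup>2) \<sigma> x" for x
  proof -
    have "- (x - \<mu>)\<^sup>2 / (2 * \<sigma>\<^sup>2) + \<theta> * x
        = \<theta> * \<mu> + \<theta>\<^sup>2 * \<sigma>\<^sup>2 / 2 + - (x - (\<mu> + \<theta> * \<sigma>\<^sup>2))\<^sup>2 / (2 * \<sigma>\<^sup>2)"
      using \<open>\<sigma> > 0\<close> by (simp add: field_simps power2_eq_square)
    then show ?thesis
      unfolding normal_density_def by (simp add: exp_add[symmetric] mult.left_commute)
  qed
  have "(\<integral>\<^sup>+\<omega>. ennreal (exp (\<theta> * X \<omega>)) \<partial>M)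
      = (\<integral>\<^sup>+x. ennreal (normal_density \<mu> \<sigma> x) * ennreal (exp (\<theta> * x)) \<partial>lborel)"
    by (rule distributed_nn_integral[OF D, symmetric]) measurable
  also have "\<dots> = (\<integral>\<^sup>+x. ennreal ?C * ennreal (normal_density (\<mu> + \<theta> * \<sigma>\<^sup>2) \<sigma> x) \<partial>lborel)"
    by (simp only: ennreal_mult[symmetric] normal_density_nonneg exp_ge_zero eq)
  also have "\<dots> = ennreal ?C * (\<integral>\<^sup>+x. ennreal (normal_density (\<mu> + \<theta> * \<sigma>\<^sup>2) \<sigma> x) \<partial>lborel)"
    by (rule nn_integral_cmult) measurable
  also have "(\<integral>\<^sup>+x. ennreal (normal_density (\<mu> + \<theta> * \<sigma>\<^sup>2) \<sigma> x) \<partial>lborel) = 1"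
    using \<open>\<sigma> > 0\<close> by (subst nn_integral_eq_integral) auto
  finally show ?thesis by simp
qed

text \<open>Expressed by the first two moments rather than the parameters, the formula also covers
  constant variables and can be passed to mean-square limits.\<close>

lemma (in prob_space) gaussian_rv_mgf:
  assumes G: "gaussian_rv M X" and int: "integrable M (\<lambda>\<omega>. (X \<omega>)\<^sup>2)"
  shows "(\<integral>\<^sup>+\<omega>. ennreal (exp (\<theta> * X \<omega>)) \<partial>M)
    = ennreal (exp (\<theta> * expectation X + \<theta>\<^sup>2 * (expectation (\<lambda>\<omega>. (X \<omega>)\<^sup>2) - (expectation X)\<^sup>2) / 2))"
proof -
  have [measurable]: "X \<in> borel_measurable M"
    using G by (simp add: gaussian_rv_def)
  have intX: "integrable M X"
    by (rule square_integrable_imp_integrable[OF _ int]) measurable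
  obtain \<mu> \<sigma> where "(\<sigma> > 0 \<and> distributed M lborel X (normal_density \<mu> \<sigma>)) \<or> (AE \<omega> in M. X \<omega> = \<mu>)"
    using G unfolding gaussian_rv_def by blast
  then show ?thesis
  proof (elim disjE conjE)
    assume "\<sigma> > 0" and D: "distributed M lborel X (normal_density \<mu> \<sigma>)"
    have "expectation X = \<mu>" "variance X = \<sigma>\<^sup>2"
      by (rule normal_distributed_expectation[OF \<open>\<sigma> > 0\<close> D] normal_distributed_variance[OF \<open>\<sigma> > 0\<close> D])+
    then show ?thesis
      using normal_distributed_mgf[OF \<open>\<sigma> > 0\<close> D, of \<theta>] variance_eq[OF intX int] by simp
  next
    assume ae: "AE \<omega> in M. X \<omega> = \<mu>"
    have "expectation X = expectation (\<lambda>_. \<mu>)"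
      by (rule integral_cong_AE) (use ae in auto)
    moreover have "expectation (\<lambda>\<omega>. (X \<omega>)\<^sup>2) = expectation (\<lambda>_. \<mu>\<^sup>2)"
      by (rule integral_cong_AE) (use ae in auto)
    moreover have "(\<integral>\<^sup>+\<omega>. ennreal (exp (\<theta> * X \<omega>)) \<partial>M) = (\<integral>\<^sup>+\<omega>. ennreal (exp (\<theta> * \<mu>)) \<partial>M)"
      using ae by (intro nn_integral_cong_AE) auto
    ultimately show ?thesis
      by (simp add: prob_space emeasure_space_1)
  qed
qed

text \<open>Mean-square convergence carries the first two moments to the limit, and Fatou along an
  almost surely convergent subsequence carries the exponential moment. An upper bound is enough for
  chaining, so the law of the limit need not be identified. The approximants need not be centred:
  their means tend to that of \<open>Z\<close>.\<close>

lemma (in prob_space) gaussian_limit_mgf: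
  fixes Z :: "'a \<Rightarrow> real" and Y :: "nat \<Rightarrow> 'a \<Rightarrow> real"
  assumes Z: "square_integrable M (\<lambda>\<omega>. of_real (Z \<omega>))" and mean: "expectation Z = 0"
    and G: "\<And>n. gaussian_rv M (Y n)" and Y: "\<And>n. square_integrable M (\<lambda>\<omega>. of_real (Y n \<omega>))"
    and lim: "(\<lambda>n. ms_norm M (\<lambda>\<omega>. of_real (Z \<omega>) - of_real (Y n \<omega>))) \<longlonglongrightarrow> 0"
  shows "(\<integral>\<^sup>+\<omega>. ennreal (exp (\<theta> * Z \<omega>)) \<partial>M) \<le> ennreal (exp (\<theta>\<^sup>2 * expectation (\<lambda>\<omega>. (Z \<omega>)\<^sup>2) / 2))"
proof -
  have Yint2: "integrable M (\<lambda>\<omega>. (Y n \<omega>)\<^sup>2)" for n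
    using Y[of n] by (simp add: square_integrable_def)
  have [measurable]: "Y n \<in> borel_measurable M" for n
    using G[of n] by (simp add: gaussian_rv_def)
  have Zint: "integrable M Z" and Yint: "integrable M (Y n)" for n
    using ms_integrable[OF Z] ms_integrable[OF Y[of n]]
    by (simp_all add: complex_of_real_integrable_eq)
  have [measurable]: "Z \<in> borel_measurable M"
    using Zint by simp
  define N where "N n = ms_norm M (\<lambda>\<omega>. complex_of_real (Z \<omega>) - of_real (Y n \<omega>))" for n
  have N2: "(N n)\<^sup>2 = expectation (\<lambda>\<omega>. (Z \<omega> - Y n \<omega>)\<^sup>2)" for n
    by (simp add: N_def ms_norm_power2 flip: of_real_diff)
  have sqd: "integrable M (\<lambda>\<omega>. (Z \<omega> - Y n \<omega>)\<^sup>2)" for n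
    using square_integrable_diff[OF Z Y[of n]] by (simp add: square_integrable_def flip: of_real_diff)
  have "(\<lambda>n. expectation (Y n)) \<longlonglongrightarrow> 0"
  proof (rule Lim_null_comparison[OF always_eventually lim], intro allI)
    fix n
    have "complex_of_real (expectation (Y n)) = (LINT \<omega>|M. (of_real (Y n \<omega>) - of_real (Z \<omega>)) * cnj 1)"
      using Zint Yint[of n] mean by (simp flip: of_real_diff)
    also have "cmod \<dots> \<le> ms_norm M (\<lambda>\<omega>. of_real (Y n \<omega>) - of_real (Z \<omega>)) * ms_norm M (\<lambda>_. 1)"
      by (intro ms_inner_le square_integrable_diff Y Z square_integrable_const)
    also have "\<dots> = ms_norm M (\<lambda>\<omega>. of_real (Z \<omega>) - of_real (Y n \<omega>))"
      by (subst ms_norm_minus) (simp add: ms_norm_def prob_space)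
    finally show "norm (expectation (Y n)) \<le> ms_norm M (\<lambda>\<omega>. of_real (Z \<omega>) - of_real (Y n \<omega>))"
      by simp
  qed
  moreover have "(\<lambda>n. expectation (\<lambda>\<omega>. (Y n \<omega>)\<^sup>2)) \<longlonglongrightarrow> expectation (\<lambda>\<omega>. (Z \<omega>)\<^sup>2)"
  proof -
    have "(\<lambda>n. ms_norm M (\<lambda>\<omega>. of_real (Y n \<omega>)) - ms_norm M (\<lambda>\<omega>. of_real (Z \<omega>))) \<longlonglongrightarrow> 0"
    proof (rule Lim_null_comparison[OF always_eventually lim], intro allI)
      fix n
      have "ms_norm M (\<lambda>\<omega>. of_real (Y n \<omega>)) \<le> ms_norm M (\<lambda>\<omega>. of_real (Y n \<omega>) - of_real (Z \<omega>)) + ms_norm M (\<lambda>\<omega>. of_real (Z \<omega>))"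
        using ms_norm_triangle[OF square_integrable_diff[OF Y[of n] Z] Z] by simp
      moreover have "ms_norm M (\<lambda>\<omega>. of_real (Z \<omega>)) \<le> ms_norm M (\<lambda>\<omega>. of_real (Z \<omega>) - of_real (Y n \<omega>)) + ms_norm M (\<lambda>\<omega>. of_real (Y n \<omega>))"
        using ms_norm_triangle[OF square_integrable_diff[OF Z Y[of n]] Y[of n]] by simp
      ultimately show "norm (ms_norm M (\<lambda>\<omega>. of_real (Y n \<omega>)) - ms_norm M (\<lambda>\<omega>. of_real (Z \<omega>)))
          \<le> ms_norm M (\<lambda>\<omega>. of_real (Z \<omega>) - of_real (Y n \<omega>))"
        using ms_norm_minus[of M "\<lambda>\<omega>. of_real (Z \<omega>)" "\<lambda>\<omega>. of_real (Y n \<omega>)"] by simp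
    qed
    then have "(\<lambda>n. ms_norm M (\<lambda>\<omega>. of_real (Y n \<omega>))) \<longlonglongrightarrow> ms_norm M (\<lambda>\<omega>. of_real (Z \<omega>))"
      by (rule LIM_zero_cancel)
    then have "(\<lambda>n. (ms_norm M (\<lambda>\<omega>. of_real (Y n \<omega>)))\<^sup>2) \<longlonglongrightarrow> (ms_norm M (\<lambda>\<omega>. of_real (Z \<omega>)))\<^sup>2"
      by (intro tendsto_intros)
    then show ?thesis
      by (simp add: ms_norm_power2)
  qed
  ultimately have lim': "(\<lambda>n. exp (\<theta> * expectation (Y n)
        + \<theta>\<^sup>2 * (expectation (\<lambda>\<omega>. (Y n \<omega>)\<^sup>2) - (expectation (Y n))\<^sup>2) / 2))
      \<longlonglongrightarrow> exp (\<theta> * 0 + \<theta>\<^sup>2 * (expectation (\<lambda>\<omega>. (Z \<omega>)\<^sup>2) - 0\<^sup>2) / 2)"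
    by (intro tendsto_intros) simp_all
  \<comment> \<open>Convergence in norm is read as L1 convergence of the squared differences, from
    which the almost surely convergent subsequence is extracted.\<close>
  have "(\<lambda>n. (N n)\<^sup>2) \<longlonglongrightarrow> 0\<^sup>2"
    using lim unfolding N_def by (intro tendsto_intros)
  then have "(\<lambda>n. LINT \<omega>|M. norm ((Z \<omega> - Y n \<omega>)\<^sup>2)) \<longlonglongrightarrow> 0"
    by (simp add: N2)
  from tendsto_L1_AE_subseq[OF sqd this]
  obtain r where r: "strict_mono r" and ae: "AE \<omega> in M. (\<lambda>n. (Z \<omega> - Y (r n) \<omega>)\<^sup>2) \<longlonglongrightarrow> 0"
    by blast
  have "AE \<omega> in M. ennreal (exp (\<theta> * Z \<omega>)) = liminf (\<lambda>n. ennreal (exp (\<theta> * Y (r n) \<omega>)))"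
    using ae
  proof eventually_elim
    case (elim \<omega>)
    have "(\<lambda>n. sqrt ((Z \<omega> - Y (r n) \<omega>)\<^sup>2)) \<longlonglongrightarrow> sqrt 0"
      using elim by (intro tendsto_intros)
    then have "(\<lambda>n. Z \<omega> - Y (r n) \<omega>) \<longlonglongrightarrow> 0"
      by (simp add: tendsto_rabs_zero_iff)
    from tendsto_diff[OF tendsto_const[of "Z \<omega>"] this] have "(\<lambda>n. Y (r n) \<omega>) \<longlonglongrightarrow> Z \<omega>"
      by simp
    then have "(\<lambda>n. ennreal (exp (\<theta> * Y (r n) \<omega>))) \<longlonglongrightarrow> ennreal (exp (\<theta> * Z \<omega>))"
      by (intro tendsto_intros)
    then show ?case
      by (intro lim_imp_Liminf[symmetric]) simp_all
  qed
  then have "(\<integral>\<^sup>+\<omega>. ennreal (exp (\<theta> * Z \<omega>)) \<partial>M) = (\<integral>\<^sup>+\<omega>. liminf (\<lambda>n. ennreal (exp (\<theta> * Y (r n) \<omega>))) \<partial>M)"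
    by (rule nn_integral_cong_AE)
  also have "\<dots> \<le> liminf (\<lambda>n. \<integral>\<^sup>+\<omega>. ennreal (exp (\<theta> * Y (r n) \<omega>)) \<partial>M)"
    by (intro nn_integral_liminf) measurable
  also have "\<dots> = liminf (\<lambda>n. ennreal (exp (\<theta> * expectation (Y (r n))
        + \<theta>\<^sup>2 * (expectation (\<lambda>\<omega>. (Y (r n) \<omega>)\<^sup>2) - (expectation (Y (r n)))\<^sup>2) / 2)))"
    unfolding gaussian_rv_mgf[OF G Yint2] ..
  also have "\<dots> = ennreal (exp (\<theta> * 0 + \<theta>\<^sup>2 * (expectation (\<lambda>\<omega>. (Z \<omega>)\<^sup>2) - 0\<^sup>2) / 2))"
    using LIMSEQ_subseq_LIMSEQ[OF lim' r]
    by (intro lim_imp_Liminf tendsto_ennrealI) (simp_all add: o_def)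
  finally show ?thesis by simp
qed

text \<open>The modulus is at most \<open>sqrt 2\<close> times the larger of the absolute real and
  imaginary parts, and that larger part is \<open>Re (u * z)\<close> for one of the four units. The
  square of \<open>sqrt 2\<close> will cancel the one half in the Gaussian exponent, and the number
  of units is the factor 4 in the exponential moments.\<close>

lemma exp_cmod_le:
  fixes z :: complex
  assumes "\<theta> \<ge> 0"
  shows "exp (\<theta> * cmod z) \<le> (\<Sum>u\<in>{1, -1, \<i>, -\<i>}. exp (sqrt 2 * \<theta> * Re (u * z)))"
proof -
  have "cmod z \<le> sqrt 2 * max \<bar>Re z\<bar> \<bar>Im z\<bar>"
  proof (rule power2_le_imp_le)
    have "(Re z)\<^sup>2 \<le> (max \<bar>Re z\<bar> \<bar>Im z\<bar>)\<^sup>2" "(Im z)\<^sup>2 \<le> (max \<bar>Re z\<bar> \<bar>Im z\<bar>)\<^sup>2"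
      by (simp_all add: abs_le_square_iff[symmetric])
    then show "(cmod z)\<^sup>2 \<le> (sqrt 2 * max \<bar>Re z\<bar> \<bar>Im z\<bar>)\<^sup>2"
      by (simp add: cmod_power2 power_mult_distrib)
  qed (simp add: max_def)
  then have "\<theta> * cmod z \<le> \<theta> * (sqrt 2 * max \<bar>Re z\<bar> \<bar>Im z\<bar>)"
    using assms by (rule mult_left_mono)
  then have "exp (\<theta> * cmod z) \<le> exp (sqrt 2 * \<theta> * max \<bar>Re z\<bar> \<bar>Im z\<bar>)"
    by (simp add: mult.assoc mult.left_commute)
  also have "exp (sqrt 2 * \<theta> * max \<bar>Re z\<bar> \<bar>Im z\<bar>) \<le> (\<Sum>u\<in>{1, -1, \<i>, -\<i>}. exp (sqrt 2 * \<theta> * Re (u * z)))"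
  proof -
    have "max \<bar>Re z\<bar> \<bar>Im z\<bar> = Re (1 * z) \<or> max \<bar>Re z\<bar> \<bar>Im z\<bar> = Re (-1 * z) \<or>
        max \<bar>Re z\<bar> \<bar>Im z\<bar> = Re (\<i> * z) \<or> max \<bar>Re z\<bar> \<bar>Im z\<bar> = Re (-\<i> * z)"
      by (auto simp: max_def abs_if)
    then obtain u where u: "u \<in> {1, -1, \<i>, -\<i>}" "max \<bar>Re z\<bar> \<bar>Im z\<bar> = Re (u * z)"
      by blast
    show ?thesis
      unfolding u(2) by (rule member_le_sum[OF u(1)]) simp_all
  qed
  finally show ?thesis .
qed

context spectral_process
begin

text \<open>The unit \<open>u\<close> treats real and imaginary parts and their negatives at once.
  Taking \<open>Re (u * _)\<close> does not increase the norm, so it preserves both the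
  approximation and the bound on the second moment.\<close>

lemma closed_span_mgf:
  assumes X: "in_closed_span M \<Phi> X" and mean: "expectation X = 0" and u: "cmod u = 1"
  shows "(\<integral>\<^sup>+\<omega>. ennreal (exp (\<theta> * Re (u * X \<omega>))) \<partial>M)
    \<le> ennreal (exp (\<theta>\<^sup>2 * expectation (\<lambda>\<omega>. (cmod (X \<omega>))\<^sup>2) / 2))"
proof -
  have sqX: "square_integrable M X"
    using X by (simp add: in_closed_span_def)
  have re_le: "square_integrable M (\<lambda>\<omega>. of_real (Re (u * V \<omega>)))"
    "ms_norm M (\<lambda>\<omega>. of_real (Re (u * V \<omega>))) \<le> ms_norm M V" if V: "square_integrable M V" for V
  proof -
    have [measurable]: "V \<in> borel_measurable M"
      using V by (rule square_integrable_measurable)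
    have le: "(Re (u * V \<omega>))\<^sup>2 \<le> (cmod (V \<omega>))\<^sup>2" for \<omega>
      using abs_Re_le_cmod[of "u * V \<omega>"] u by (simp add: norm_mult abs_le_square_iff[symmetric])
    have int: "integrable M (\<lambda>\<omega>. (Re (u * V \<omega>))\<^sup>2)"
      by (rule Bochner_Integration.integrable_bound[of _ "\<lambda>\<omega>. (cmod (V \<omega>))\<^sup>2"])
        (use V le in \<open>auto simp: square_integrable_def\<close>)
    then show "square_integrable M (\<lambda>\<omega>. of_real (Re (u * V \<omega>)))"
      by (simp add: square_integrable_def del: times_complex.sel)
    have "(LINT \<omega>|M. (Re (u * V \<omega>))\<^sup>2) \<le> (LINT \<omega>|M. (cmod (V \<omega>))\<^sup>2)"
      by (rule integral_mono[OF int _ le]) (use V in \<open>auto simp: square_integrable_def\<close>)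
    then show "ms_norm M (\<lambda>\<omega>. of_real (Re (u * V \<omega>))) \<le> ms_norm M V"
      by (simp add: ms_norm_def del: times_complex.sel)
  qed
  have "\<forall>n. \<exists>P. finite (fst P) \<and>
      ms_norm M (\<lambda>\<omega>. X \<omega> - (\<Sum>t\<in>fst P. snd P t * of_real (\<Phi> t \<omega>))) < inverse (real (Suc n))"
  proof
    fix n
    have "inverse (real (Suc n)) > 0"
      by simp
    from X[unfolded in_closed_span_def, THEN conjunct2, rule_format, OF this]
    obtain J c where "finite J"
      "ms_norm M (\<lambda>\<omega>. X \<omega> - (\<Sum>t\<in>J. c t * of_real (\<Phi> t \<omega>))) < inverse (real (Suc n))"
      by blast
    then show "\<exists>P. finite (fst P) \<and>
        ms_norm M (\<lambda>\<omega>. X \<omega> - (\<Sum>t\<in>fst P. snd P t * of_real (\<Phi> t \<omega>))) < inverse (real (Suc n))"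
      by (intro exI[of _ "(J, c)"]) simp
  qed
  from choice[OF this] obtain P where P: "finite (fst (P n))"
    "ms_norm M (\<lambda>\<omega>. X \<omega> - (\<Sum>t\<in>fst (P n). snd (P n) t * of_real (\<Phi> t \<omega>))) < inverse (real (Suc n))" for n
    by blast
  define J where "J n = fst (P n)" for n
  define c where "c n = snd (P n)" for n
  note J = P(1)[folded J_def] and c = P(2)[folded J_def c_def]
  \<comment> \<open>Because the process is real, taking the real part only changes the coefficients,
    and the Gaussian hypothesis applies to \<open>Y n\<close> directly.\<close>
  define Y where "Y n \<omega> = (\<Sum>t\<in>J n. Re (u * c n t) * \<Phi> t \<omega>)" for n \<omega>
  have Yeq: "Y n \<omega> = Re (u * (\<Sum>t\<in>J n. c n t * of_real (\<Phi> t \<omega>)))" for n \<omega>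
    by (simp add: Y_def sum_distrib_left mult.assoc[symmetric])
  have sqC: "square_integrable M (\<lambda>\<omega>. \<Sum>t\<in>J n. c n t * of_real (\<Phi> t \<omega>))" for n
    by (intro square_integrable_sum square_integrable_scale process_square_integrable)
  have "(\<integral>\<^sup>+\<omega>. ennreal (exp (\<theta> * Re (u * X \<omega>))) \<partial>M)
      \<le> ennreal (exp (\<theta>\<^sup>2 * expectation (\<lambda>\<omega>. (Re (u * X \<omega>))\<^sup>2) / 2))"
  proof (rule gaussian_limit_mgf[where Y = Y])
    show "square_integrable M (\<lambda>\<omega>. of_real (Re (u * X \<omega>)))"
      by (rule re_le(1)[OF sqX])
    show "expectation (\<lambda>\<omega>. Re (u * X \<omega>)) = 0"
      using mean ms_integrable[OF sqX] by (subst integral_Re) simp_all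
    show "gaussian_rv M (Y n)" for n
      unfolding Y_def
      by (rule gaussian[unfolded gaussian_process_def, THEN conjunct2, rule_format, OF J])
    show "square_integrable M (\<lambda>\<omega>. of_real (Y n \<omega>))" for n
      unfolding Yeq by (rule re_le(1)[OF sqC])
    show "(\<lambda>n. ms_norm M (\<lambda>\<omega>. of_real (Re (u * X \<omega>)) - of_real (Y n \<omega>))) \<longlonglongrightarrow> 0"
    proof (rule Lim_null_comparison[OF always_eventually LIMSEQ_inverse_real_of_nat], intro allI)
      fix n
      have eq: "(\<lambda>\<omega>. complex_of_real (Re (u * X \<omega>)) - of_real (Y n \<omega>))
          = (\<lambda>\<omega>. of_real (Re (u * (X \<omega> - (\<Sum>t\<in>J n. c n t * of_real (\<Phi> t \<omega>))))))"
        unfolding Yeq right_diff_distrib minus_complex.sel of_real_diff ..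
      have "ms_norm M (\<lambda>\<omega>. of_real (Re (u * X \<omega>)) - of_real (Y n \<omega>))
          \<le> ms_norm M (\<lambda>\<omega>. X \<omega> - (\<Sum>t\<in>J n. c n t * of_real (\<Phi> t \<omega>)))"
        unfolding eq by (rule re_le(2)[OF square_integrable_diff[OF sqX sqC]])
      also have "\<dots> \<le> inverse (real (Suc n))"
        using c[of n] by (rule less_imp_le)
      finally show "norm (ms_norm M (\<lambda>\<omega>. of_real (Re (u * X \<omega>)) - of_real (Y n \<omega>))) \<le> inverse (real (Suc n))"
        unfolding real_norm_def abs_of_nonneg[OF ms_norm_nonneg] .
    qed
  qed
  also have "\<dots> \<le> ennreal (exp (\<theta>\<^sup>2 * expectation (\<lambda>\<omega>. (cmod (X \<omega>))\<^sup>2) / 2))"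
  proof -
    have "ms_norm M (\<lambda>\<omega>. of_real (Re (u * X \<omega>))) \<le> ms_norm M X"
      by (rule re_le(2)[OF sqX])
    then have "expectation (\<lambda>\<omega>. (Re (u * X \<omega>))\<^sup>2) \<le> expectation (\<lambda>\<omega>. (cmod (X \<omega>))\<^sup>2)"
      unfolding ms_norm_def real_sqrt_le_iff norm_of_real power2_abs .
    then show ?thesis
      by (intro ennreal_leI) (simp add: mult_left_mono)
  qed
  finally show ?thesis .
qed

text \<open>The variances of the real and imaginary parts need not be known: each is bounded by the
  full second moment, which is what the spectral formula provides.\<close>

lemma weighted_integral_mgf:
  assumes X: "weighted_integral g X" and \<sigma>: "expectation (\<lambda>\<omega>. (cmod (X \<omega>))\<^sup>2) \<le> \<sigma>\<^sup>2" and \<theta>: "\<theta> \<ge> 0"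
  shows "(\<integral>\<^sup>+\<omega>. ennreal (exp (\<theta> * cmod (X \<omega>))) \<partial>M) \<le> ennreal (4 * exp (\<theta>\<^sup>2 * \<sigma>\<^sup>2))"
proof -
  let ?U = "{1, -1, \<i>, -\<i>} :: complex set"
  have [measurable]: "X \<in> borel_measurable M"
    using weighted_integralD(4)[OF X] by (rule square_integrable_measurable)
  have "(\<integral>\<^sup>+\<omega>. ennreal (exp (\<theta> * cmod (X \<omega>))) \<partial>M)
      \<le> (\<integral>\<^sup>+\<omega>. (\<Sum>u\<in>?U. ennreal (exp (sqrt 2 * \<theta> * Re (u * X \<omega>)))) \<partial>M)"
    using exp_cmod_le[OF \<theta>] by (intro nn_integral_mono) (simp add: sum_ennreal ennreal_leI del: sum.insert)
  also have "\<dots> = (\<Sum>u\<in>?U. \<integral>\<^sup>+\<omega>. ennreal (exp (sqrt 2 * \<theta> * Re (u * X \<omega>))) \<partial>M)"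
    by (rule nn_integral_sum) measurable
  also have "\<dots> \<le> (\<Sum>u\<in>?U. ennreal (exp (\<theta>\<^sup>2 * \<sigma>\<^sup>2)))"
  proof (rule sum_mono)
    fix u assume "u \<in> ?U"
    then have "cmod u = 1"
      by auto
    from closed_span_mgf[OF weighted_integralD(3)[OF X] weighted_integral_mean[OF X] this]
    have "(\<integral>\<^sup>+\<omega>. ennreal (exp (sqrt 2 * \<theta> * Re (u * X \<omega>))) \<partial>M)
        \<le> ennreal (exp ((sqrt 2 * \<theta>)\<^sup>2 * expectation (\<lambda>\<omega>. (cmod (X \<omega>))\<^sup>2) / 2))" .
    also have "\<dots> \<le> ennreal (exp (\<theta>\<^sup>2 * \<sigma>\<^sup>2))"
      using \<sigma> by (intro ennreal_leI) (simp add: power_mult_distrib mult_left_mono)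
    finally show "(\<integral>\<^sup>+\<omega>. ennreal (exp (sqrt 2 * \<theta> * Re (u * X \<omega>))) \<partial>M) \<le> ennreal (exp (\<theta>\<^sup>2 * \<sigma>\<^sup>2))" .
  qed
  also have "\<dots> = ennreal (4 * exp (\<theta>\<^sup>2 * \<sigma>\<^sup>2))"
  proof -
    have "card ?U = 4"
      by (simp add: card_insert_if complex_eq_iff)
    then show ?thesis
      by (simp add: ennreal_mult del: sum.insert)
  qed
  finally show ?thesis .
qed

end

section \<open>Maximal inequalities and chaining\<close>

text \<open>Proved from \<open>ln x \<le> ln a + x / a - 1\<close> instead of Jensen's inequality, so that nothing need be
  known about the integrability of the supremum.\<close>

lemma (in prob_space) expectation_max_le:
  fixes Z :: "'i \<Rightarrow> 'a \<Rightarrow> complex" and N b :: real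
  assumes I: "finite I" "real (card I) \<le> N" and N: "N \<ge> 1" and b: "b > 0"
    and meas: "\<And>i. i \<in> I \<Longrightarrow> Z i \<in> borel_measurable M"
    and mgf: "\<And>i \<theta>. i \<in> I \<Longrightarrow> \<theta> \<ge> 0 \<Longrightarrow>
      (\<integral>\<^sup>+\<omega>. ennreal (exp (\<theta> * cmod (Z i \<omega>))) \<partial>M) \<le> ennreal (4 * exp (\<theta>\<^sup>2 * b\<^sup>2))"
  shows "(\<integral>\<^sup>+\<omega>. (SUP i\<in>I. ennreal (cmod (Z i \<omega>))) \<partial>M) \<le> ennreal (2 * b * sqrt (ln (4 * N)))"
proof -
  \<comment> \<open>\<open>\<theta>\<close> is chosen so that
    \<open>exp (\<theta>\<^sup>2 * b\<^sup>2) = 4 * N\<close>. The reference point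
    \<open>a = (4 * N)\<^sup>2\<close> makes the total of at most \<open>N\<close> exponential
    terms, each with mean at most \<open>16 * N\<close>, at most \<open>1 / \<theta>\<close> after
    the factor \<open>1 / (a * \<theta>)\<close>; this cancels the \<open>- 1\<close> of the
    logarithmic inequality.\<close>
  define l where "l = ln (4 * N)"
  define \<theta> where "\<theta> = sqrt l / b"
  define a where "a = 16 * N\<^sup>2"
  have "1 \<le> ln (4::real)"
    using exp_le by (subst ln_ge_iff) auto
  also have "\<dots> \<le> l"
    using N by (simp add: l_def)
  finally have l: "l \<ge> 1" .
  have \<theta>: "\<theta> > 0" and a: "a > 0"
    using l b N by (simp_all add: \<theta>_def a_def)
  have "\<theta>\<^sup>2 * b\<^sup>2 = l"
    using l b by (simp add: \<theta>_def power_divide)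
  then have e: "exp (\<theta>\<^sup>2 * b\<^sup>2) = 4 * N"
    using N by (simp add: l_def)
  have "a = (4 * N) ^ 2"
    by (simp add: a_def power_mult_distrib)
  then have lna: "ln a = 2 * l"
    using N ln_realpow[of "4 * N" 2] by (simp only: l_def)
  have pt: "z \<le> (2 * l - 1) / \<theta> + 1 / (a * \<theta>) * exp (\<theta> * z)" for z
  proof -
    have "ln (exp (\<theta> * z) / a) \<le> exp (\<theta> * z) / a - 1"
      using a by (intro ln_le_minus_one) simp
    then have "\<theta> * z \<le> 2 * l - 1 + exp (\<theta> * z) / a"
      using a by (simp add: ln_div lna)
    then show ?thesis
      using \<theta> a by (simp add: field_simps)
  qed
  define c where "c = (2 * l - 1) / \<theta>"
  define d where "d = 1 / (a * \<theta>)"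
  have cd: "c \<ge> 0" "d \<ge> 0"
    using l \<theta> a by (simp_all add: c_def d_def)
  have "(\<integral>\<^sup>+\<omega>. (SUP i\<in>I. ennreal (cmod (Z i \<omega>))) \<partial>M)
      \<le> (\<integral>\<^sup>+\<omega>. ennreal c + (\<Sum>i\<in>I. ennreal d * ennreal (exp (\<theta> * cmod (Z i \<omega>)))) \<partial>M)"
  proof (intro nn_integral_mono SUP_least)
    fix \<omega> i assume i: "i \<in> I"
    have "ennreal (cmod (Z i \<omega>)) \<le> ennreal (c + d * exp (\<theta> * cmod (Z i \<omega>)))"
      using pt[of "cmod (Z i \<omega>)"] by (intro ennreal_leI) (simp add: c_def d_def)
    also have "\<dots> = ennreal c + ennreal d * ennreal (exp (\<theta> * cmod (Z i \<omega>)))"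
      using cd by (simp add: ennreal_mult)
    also have "ennreal d * ennreal (exp (\<theta> * cmod (Z i \<omega>)))
        \<le> (\<Sum>i\<in>I. ennreal d * ennreal (exp (\<theta> * cmod (Z i \<omega>))))"
      using I i by (intro member_le_sum) auto
    finally show "ennreal (cmod (Z i \<omega>)) \<le> ennreal c + (\<Sum>i\<in>I. ennreal d * ennreal (exp (\<theta> * cmod (Z i \<omega>))))"
      by (simp add: add_left_mono)
  qed
  also have "\<dots> = ennreal c + (\<Sum>i\<in>I. ennreal d * (\<integral>\<^sup>+\<omega>. ennreal (exp (\<theta> * cmod (Z i \<omega>))) \<partial>M))"
    using meas by (simp add: nn_integral_add nn_integral_sum nn_integral_cmult emeasure_space_1)
  also have "\<dots> \<le> ennreal c + (\<Sum>i\<in>I. ennreal d * ennreal (16 * N))"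
    using mgf[OF _ less_imp_le[OF \<theta>]] by (intro add_left_mono sum_mono mult_left_mono) (simp_all add: e)
  also have "\<dots> = ennreal (c + real (card I) * (d * (16 * N)))"
    using cd N by (simp add: ennreal_mult[symmetric] ennreal_of_nat_eq_real_of_nat)
  also have "\<dots> \<le> ennreal (c + N * (d * (16 * N)))"
    using cd N I by (intro ennreal_leI add_left_mono mult_right_mono) auto
  also have "c + N * (d * (16 * N)) = 2 * l / \<theta>"
    using N \<theta> by (simp add: c_def d_def a_def field_simps power2_eq_square)
  also have "\<dots> = 2 * b * sqrt l"
    using l b real_sqrt_mult_self[of l] by (simp add: \<theta>_def field_simps)
  finally show ?thesis by (simp add: l_def)
qed

lemma SUP_cmod_link:
  fixes X :: "'i \<Rightarrow> complex"
  assumes "\<And>u. u \<in> A \<Longrightarrow> \<pi> u \<in> B"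
  shows "(SUP u\<in>A. ennreal (cmod (X u)))
    \<le> (SUP u\<in>A. ennreal (cmod (X u - X (\<pi> u)))) + (SUP v\<in>B. ennreal (cmod (X v)))"
proof (rule SUP_least)
  fix u assume u: "u \<in> A"
  have "ennreal (cmod (X u)) \<le> ennreal (cmod (X u - X (\<pi> u)) + cmod (X (\<pi> u)))"
    using norm_triangle_ineq[of "X u - X (\<pi> u)" "X (\<pi> u)"] by (intro ennreal_leI) simp
  also have "\<dots> = ennreal (cmod (X u - X (\<pi> u))) + ennreal (cmod (X (\<pi> u)))"
    by simp
  also have "\<dots> \<le> (SUP u\<in>A. ennreal (cmod (X u - X (\<pi> u)))) + (SUP v\<in>B. ennreal (cmod (X v)))"
    using u assms[OF u] by (intro add_mono SUP_upper2[where i = u] SUP_upper2[where i = "\<pi> u"]) auto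
  finally show "ennreal (cmod (X u)) \<le> \<dots>" .
qed

text \<open>Since \<open>\<pi> k\<close> is a fixed map, the points of one level give at most as
  many links as that level has points, so only \<open>N\<close> of the finer level enters. The
  finite set \<open>F\<close> is attached to level \<open>K\<close> by one extra link; its cost
  depends on the size of \<open>F\<close> but carries the small factor
  \<open>b (Suc K)\<close>.\<close>

lemma (in prob_space) chaining_bound:
  fixes X :: "'i \<Rightarrow> 'a \<Rightarrow> complex" and T :: "nat \<Rightarrow> 'i set" and \<pi> :: "nat \<Rightarrow> 'i \<Rightarrow> 'i"
    and N b :: "nat \<Rightarrow> real"
  assumes meas: "\<And>u. u \<in> I \<Longrightarrow> X u \<in> borel_measurable M"
    and T: "\<And>k. finite (T k)" "\<And>k. T k \<subseteq> I" "\<And>k. real (card (T k)) \<le> N k"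
    and N: "\<And>k. N k \<ge> 1" and b: "\<And>k. b k > 0"
    and \<pi>: "\<And>k u. u \<in> I \<Longrightarrow> \<pi> k u \<in> T k"
    and root: "\<And>u \<theta>. u \<in> I \<Longrightarrow> \<theta> \<ge> 0 \<Longrightarrow>
      (\<integral>\<^sup>+\<omega>. ennreal (exp (\<theta> * cmod (X u \<omega>))) \<partial>M) \<le> ennreal (4 * exp (\<theta>\<^sup>2 * (b 0)\<^sup>2))"
    and link: "\<And>k u \<theta>. u \<in> I \<Longrightarrow> \<theta> \<ge> 0 \<Longrightarrow>
      (\<integral>\<^sup>+\<omega>. ennreal (exp (\<theta> * cmod (X u \<omega> - X (\<pi> k u) \<omega>))) \<partial>M)
        \<le> ennreal (4 * exp (\<theta>\<^sup>2 * (b (Suc k))\<^sup>2))"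
    and F: "finite F" "F \<subseteq> I" "real (card F) \<le> n" "n \<ge> 1"
  shows "(\<integral>\<^sup>+\<omega>. (SUP u\<in>F. ennreal (cmod (X u \<omega>))) \<partial>M)
    \<le> ennreal ((\<Sum>k\<le>K. 2 * b k * sqrt (ln (4 * N k))) + 2 * b (Suc K) * sqrt (ln (4 * n)))"
proof -
  have lnN: "0 \<le> b k * sqrt (ln (4 * x))" if "x \<ge> 1" for k x
    using that less_imp_le[OF b[of k]] by simp
  \<comment> \<open>Stated for any finite set above level \<open>k\<close>, so that it serves both
    between consecutive levels and for the final link from \<open>F\<close>.\<close>
  have step: "(\<integral>\<^sup>+\<omega>. (SUP u\<in>A. ennreal (cmod (X u \<omega>))) \<partial>M)
      \<le> ennreal (2 * b (Suc k) * sqrt (ln (4 * x))) + (\<integral>\<^sup>+\<omega>. (SUP u\<in>T k. ennreal (cmod (X u \<omega>))) \<partial>M)"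
    if A: "finite A" "A \<subseteq> I" "real (card A) \<le> x" "x \<ge> 1" for A k x
  proof -
    have Xm: "X u \<in> borel_measurable M" "(\<lambda>\<omega>. X u \<omega> - X (\<pi> k u) \<omega>) \<in> borel_measurable M" if "u \<in> A" for u
      using meas A(2) T(2)[of k] \<pi>[of u k] that by (auto intro!: borel_measurable_diff)
    have "(\<integral>\<^sup>+\<omega>. (SUP u\<in>A. ennreal (cmod (X u \<omega>))) \<partial>M)
        \<le> (\<integral>\<^sup>+\<omega>. (SUP u\<in>A. ennreal (cmod (X u \<omega> - X (\<pi> k u) \<omega>))) + (SUP u\<in>T k. ennreal (cmod (X u \<omega>))) \<partial>M)"
      using A(2) \<pi> by (intro nn_integral_mono SUP_cmod_link) auto
    also have "\<dots> = (\<integral>\<^sup>+\<omega>. (SUP u\<in>A. ennreal (cmod (X u \<omega> - X (\<pi> k u) \<omega>))) \<partial>M)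
        + (\<integral>\<^sup>+\<omega>. (SUP u\<in>T k. ennreal (cmod (X u \<omega>))) \<partial>M)"
      using A T(1,2)[of k] Xm meas
      by (intro nn_integral_add borel_measurable_SUP countable_finite) auto
    also have "(\<integral>\<^sup>+\<omega>. (SUP u\<in>A. ennreal (cmod (X u \<omega> - X (\<pi> k u) \<omega>))) \<partial>M)
        \<le> ennreal (2 * b (Suc k) * sqrt (ln (4 * x)))"
      using A b Xm link by (intro expectation_max_le) auto
    finally show ?thesis by (simp add: add_right_mono)
  qed
  have level: "(\<integral>\<^sup>+\<omega>. (SUP u\<in>T k. ennreal (cmod (X u \<omega>))) \<partial>M)
      \<le> ennreal (\<Sum>j\<le>k. 2 * b j * sqrt (ln (4 * N j)))" for k
  proof (induction k)
    case 0
    have "(\<integral>\<^sup>+\<omega>. (SUP u\<in>T 0. ennreal (cmod (X u \<omega>))) \<partial>M) \<le> ennreal (2 * b 0 * sqrt (ln (4 * N 0)))"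
      using T(1,2,3)[of 0] N b meas root by (intro expectation_max_le) auto
    then show ?case by simp
  next
    case (Suc k)
    have "(\<integral>\<^sup>+\<omega>. (SUP u\<in>T (Suc k). ennreal (cmod (X u \<omega>))) \<partial>M)
        \<le> ennreal (2 * b (Suc k) * sqrt (ln (4 * N (Suc k)))) + (\<integral>\<^sup>+\<omega>. (SUP u\<in>T k. ennreal (cmod (X u \<omega>))) \<partial>M)"
      by (intro step T N)
    also have "\<dots> \<le> ennreal (2 * b (Suc k) * sqrt (ln (4 * N (Suc k)))) + ennreal (\<Sum>j\<le>k. 2 * b j * sqrt (ln (4 * N j)))"
      by (intro add_left_mono Suc.IH)
    also have "\<dots> = ennreal (\<Sum>j\<le>Suc k. 2 * b j * sqrt (ln (4 * N j)))"
      using lnN[OF N] by (subst ennreal_plus[symmetric]) (auto simp: mult.assoc add.commute intro!: sum_nonneg)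
    finally show ?case .
  qed
  have "(\<integral>\<^sup>+\<omega>. (SUP u\<in>F. ennreal (cmod (X u \<omega>))) \<partial>M)
      \<le> ennreal (2 * b (Suc K) * sqrt (ln (4 * n))) + ennreal (\<Sum>k\<le>K. 2 * b k * sqrt (ln (4 * N k)))"
    using step[OF F, of K] level[of K] by (meson add_left_mono order.trans)
  also have "\<dots> = ennreal ((\<Sum>k\<le>K. 2 * b k * sqrt (ln (4 * N k))) + 2 * b (Suc K) * sqrt (ln (4 * n)))"
    using lnN[OF N] lnN[OF F(4)]
    by (subst ennreal_plus[symmetric]) (auto simp: mult.assoc add.commute intro!: sum_nonneg)
  finally show ?thesis .
qed

text \<open>Path continuity bounds the supremum by that over positive rationals, which is an
  increasing limit of suprema over finite sets. The uncountable supremum is only compared pointwise,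
  so its measurability does not arise.\<close>

lemma nn_integral_SUP_positive_reals_le:
  fixes W :: "real \<Rightarrow> 'w \<Rightarrow> complex"
  assumes meas: "\<And>s. s > 0 \<Longrightarrow> W s \<in> borel_measurable M"
    and cont: "\<And>\<omega>. \<omega> \<in> space M \<Longrightarrow> continuous_on {0<..} (\<lambda>s. W s \<omega>)"
    and fin: "\<And>F. finite F \<Longrightarrow> F \<subseteq> {0<..} \<Longrightarrow> (\<integral>\<^sup>+\<omega>. (SUP s\<in>F. ennreal (cmod (W s \<omega>))) \<partial>M) \<le> B"
  shows "(\<integral>\<^sup>+\<omega>. (SUP s\<in>{0<..}. ennreal (cmod (W s \<omega>))) \<partial>M) \<le> B"
proof -
  define Q where "Q = {0<..} \<inter> (\<rat> :: real set)"
  define q where "q = from_nat_into Q"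
  have Q: "countable Q" "Q \<noteq> {}"
  proof -
    show "countable Q"
      unfolding Q_def by (rule countable_subset[OF _ countable_rat]) auto
    have "1 \<in> Q"
      by (simp add: Q_def)
    then show "Q \<noteq> {}" by auto
  qed
  have range: "range q = Q"
    unfolding q_def by (rule range_from_nat_into[OF Q(2,1)])
  then have q: "q n \<in> Q" "q n > 0" for n
    by (auto simp: Q_def)
  define S where "S n \<omega> = (SUP s\<in>q ` {..n}. ennreal (cmod (W s \<omega>)))" for n \<omega>
  have "(\<integral>\<^sup>+\<omega>. (SUP s\<in>{0<..}. ennreal (cmod (W s \<omega>))) \<partial>M) \<le> (\<integral>\<^sup>+\<omega>. (SUP n. S n \<omega>) \<partial>M)"
  proof (intro nn_integral_mono SUP_least)
    fix \<omega> and s :: real assume \<omega>: "\<omega> \<in> space M" and s: "s \<in> {0<..}"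
    define f where "f = (\<lambda>s. ennreal (cmod (W s \<omega>)))"
    show "ennreal (cmod (W s \<omega>)) \<le> (SUP n. S n \<omega>)"
    proof (rule ccontr)
      assume "\<not> ?thesis"
      then have less: "(SUP n. S n \<omega>) < f s"
        by (simp add: f_def)
      have "((\<lambda>s. W s \<omega>) \<longlongrightarrow> W s \<omega>) (at s)"
        using cont[OF \<omega>] s by (simp add: continuous_on_eq_continuous_at isCont_def)
      then have "(f \<longlongrightarrow> f s) (at s)"
        unfolding f_def by (intro tendsto_ennrealI tendsto_norm)
      then have "(f \<longlongrightarrow> f s) (nhds s)"
        by (simp add: tendsto_nhds_iff)
      then have "\<forall>\<^sub>F x in nhds s. (SUP n. S n \<omega>) < f x"
        using less by (rule order_tendstoD(1))
      moreover have "\<forall>\<^sub>F x in nhds s. x > 0"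
        using s by (intro eventually_nhds_in_open[of "{0<..}", simplified]) auto
      ultimately have "\<forall>\<^sub>F x in nhds s. (SUP n. S n \<omega>) < f x \<and> x > 0"
        by (rule eventually_conj)
      then obtain d where d: "d > 0" "\<And>x. dist x s < d \<Longrightarrow> (SUP n. S n \<omega>) < f x \<and> x > 0"
        unfolding eventually_nhds_metric by blast
      \<comment> \<open>A value strictly above the rational supremum persists in a neighbourhood of
        \<open>s\<close>, and that neighbourhood contains a rational.\<close>
      obtain x where x: "x \<in> \<rat>" "s < x" "x < s + d"
        using Rats_dense_in_real[of s "s + d"] d(1) by auto
      have "dist x s < d"
        using x by (simp add: dist_real_def)
      with d(2) x(1) have "x \<in> Q" "(SUP n. S n \<omega>) < f x"
        by (auto simp: Q_def)
      then obtain n where "x = q n"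
        using range by blast
      then have "f x \<le> S n \<omega>"
        unfolding S_def f_def by (intro SUP_upper2[of "q n"]) auto
      also have "\<dots> \<le> (SUP n. S n \<omega>)"
        by (rule SUP_upper) simp
      finally show False
        using \<open>(SUP n. S n \<omega>) < f x\<close> by simp
    qed
  qed
  also have "\<dots> = (SUP n. \<integral>\<^sup>+\<omega>. S n \<omega> \<partial>M)"
  proof (rule nn_integral_monotone_convergence_SUP)
    show "incseq S"
      by (intro incseq_SucI le_funI) (auto simp: S_def intro!: SUP_subset_mono)
    show "S n \<in> borel_measurable M" for n
      unfolding S_def using meas q by (intro borel_measurable_SUP countable_finite) auto
  qed
  also have "\<dots> \<le> B"
    unfolding S_def using q by (intro SUP_least fin) auto
  finally show ?thesis .
qed

section \<open>The wavelet transform\<close>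

lemma nn_integral_powr_from_0:
  fixes a c :: real
  assumes "a > -1" "c \<ge> 0"
  shows "(\<integral>\<^sup>+x. ennreal (if x \<in> {0..c} then x powr a else 0) \<partial>lborel) = ennreal (c powr (a + 1) / (a + 1))"
proof (rule nn_integral_has_integral_lborel)
  show "((\<lambda>x. if x \<in> {0..c} then x powr a else 0) has_integral c powr (a + 1) / (a + 1)) UNIV"
    unfolding has_integral_restrict_UNIV by (rule has_integral_powr_from_0[OF assms])
qed simp_all

lemma nn_integral_powr_to_inf:
  fixes a e :: real
  assumes "e < -1" "a > 0"
  shows "(\<integral>\<^sup>+x. ennreal (if x \<in> {a..} then x powr e else 0) \<partial>lborel) = ennreal (- (a powr (e + 1)) / (e + 1))"
proof (rule nn_integral_has_integral_lborel)
  show "((\<lambda>x. if x \<in> {a..} then x powr e else 0) has_integral - (a powr (e + 1)) / (e + 1)) UNIV"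
    unfolding has_integral_restrict_UNIV by (rule has_integral_powr_to_inf[OF assms])
qed simp_all

text \<open>The frequency axis is cut at \<open>A / B\<close>, where the bounds \<open>A\<close> and
  \<open>B * l\<close> coincide. Below the cut the linear bound leaves the power
  \<open>1 - \<gamma>\<close>, integrable at zero since \<open>\<gamma> < 2\<close>; above it the
  constant bound leaves \<open>- (1 + \<gamma>)\<close>, integrable at infinity since
  \<open>\<gamma> > 0\<close>. At this cut both pieces carry the same powers of \<open>A\<close> and
  \<open>B\<close>.\<close>

lemma integral_cmod_power2_density_le:
  fixes p :: "real \<Rightarrow> real" and h :: "real \<Rightarrow> complex"
  assumes \<gamma>: "0 < \<gamma>" "\<gamma> < 2" and C: "C > 0"
    and [measurable]: "p \<in> borel_measurable borel" "h \<in> borel_measurable borel"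
    and p: "\<And>l. p l \<ge> 0" "\<And>l. l \<noteq> 0 \<Longrightarrow> p l \<le> C * \<bar>l\<bar> powr (- (1 + \<gamma>))"
    and h0: "\<And>l. l \<le> 0 \<Longrightarrow> h l = 0"
    and hA: "\<And>l. cmod (h l) \<le> A" and hB: "\<And>l. l > 0 \<Longrightarrow> cmod (h l) \<le> B * l"
  shows "(LINT l|lborel. (cmod (h l))\<^sup>2 * p l)
    \<le> C * (1 / \<gamma> + 1 / (2 - \<gamma>)) * A powr (2 - \<gamma>) * B powr \<gamma>"
proof -
  have A: "A \<ge> 0"
    using hA[of 0] by (rule order.trans[rotated]) simp
  have B: "B \<ge> 0"
    using hB[of 1] order.trans[OF norm_ge_zero[of "h 1"]] by simp
  have rhs: "0 \<le> C * (1 / \<gamma> + 1 / (2 - \<gamma>)) * A powr (2 - \<gamma>) * B powr \<gamma>"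
    using \<gamma> C by simp
  show ?thesis
  \<comment> \<open>The cut is neither zero nor undefined only if both constants are positive;
    otherwise \<open>h\<close> vanishes identically.\<close>
  proof (cases "A = 0 \<or> B = 0")
    case True
    have "h l = 0" for l
      using True hA[of l] hB[of l] h0[of l] by (cases "l \<le> 0") auto
    with rhs show ?thesis by simp
  next
    case False
    with A B have AB: "A > 0" "B > 0"
      by auto
    define \<Lambda> where "\<Lambda> = A / B"
    have \<Lambda>: "\<Lambda> > 0"
      using AB by (simp add: \<Lambda>_def)
    have pt: "(cmod (h l))\<^sup>2 * p l \<le> C * B\<^sup>2 * (if l \<in> {0..\<Lambda>} then l powr (1 - \<gamma>) else 0)
        + C * A\<^sup>2 * (if l \<in> {\<Lambda>..} then l powr (- (1 + \<gamma>)) else 0)" (is "_ \<le> ?u l + ?v l") for l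
    proof -
      have uv: "?u l \<ge> 0" "?v l \<ge> 0"
        using C by auto
      consider "l \<le> 0" | "0 < l" "l \<le> \<Lambda>" | "l > \<Lambda>"
        by linarith
      then show ?thesis
      proof cases
        case 1
        then show ?thesis
          using uv by (simp add: h0)
      next
        case 2
        have "(cmod (h l))\<^sup>2 * p l \<le> (B * l)\<^sup>2 * (C * l powr (- (1 + \<gamma>)))"
          using hB[of l] p[of l] 2 by (intro mult_mono power_mono) auto
        also have "\<dots> = C * B\<^sup>2 * (l powr 2 * l powr (- (1 + \<gamma>)))"
          using 2 by (simp add: power_mult_distrib)
        also have "\<dots> = ?u l"
          using 2 by (simp only: powr_add[symmetric]) (simp add: algebra_simps)
        finally show ?thesis
          using uv by linarith
      next
        case 3
        have "(cmod (h l))\<^sup>2 * p l \<le> A\<^sup>2 * (C * l powr (- (1 + \<gamma>)))"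
          using hA[of l] p[of l] 3 \<Lambda> by (intro mult_mono power_mono) auto
        also have "\<dots> = ?v l"
          using 3 by simp
        finally show ?thesis
          using uv by linarith
      qed
    qed
    have "(\<integral>\<^sup>+l. ennreal ((cmod (h l))\<^sup>2 * p l) \<partial>lborel)
        \<le> (\<integral>\<^sup>+l. ennreal (C * B\<^sup>2) * ennreal (if l \<in> {0..\<Lambda>} then l powr (1 - \<gamma>) else 0)
          + ennreal (C * A\<^sup>2) * ennreal (if l \<in> {\<Lambda>..} then l powr (- (1 + \<gamma>)) else 0) \<partial>lborel)"
    proof (rule nn_integral_mono)
      fix l
      have "ennreal ((cmod (h l))\<^sup>2 * p l) \<le> ennreal (C * B\<^sup>2 * (if l \<in> {0..\<Lambda>} then l powr (1 - \<gamma>) else 0)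
        + C * A\<^sup>2 * (if l \<in> {\<Lambda>..} then l powr (- (1 + \<gamma>)) else 0))"
        by (rule ennreal_leI[OF pt])
      also have "\<dots> = ennreal (C * B\<^sup>2) * ennreal (if l \<in> {0..\<Lambda>} then l powr (1 - \<gamma>) else 0)
          + ennreal (C * A\<^sup>2) * ennreal (if l \<in> {\<Lambda>..} then l powr (- (1 + \<gamma>)) else 0)"
        using C by (subst ennreal_plus) (auto simp: ennreal_mult)
      finally show "ennreal ((cmod (h l))\<^sup>2 * p l) \<le> \<dots>" .
    qed
    also have "\<dots> = ennreal (C * B\<^sup>2) * (\<integral>\<^sup>+l. ennreal (if l \<in> {0..\<Lambda>} then l powr (1 - \<gamma>) else 0) \<partial>lborel)
        + ennreal (C * A\<^sup>2) * (\<integral>\<^sup>+l. ennreal (if l \<in> {\<Lambda>..} then l powr (- (1 + \<gamma>)) else 0) \<partial>lborel)"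
    proof -
      have [measurable]: "(\<lambda>l. ennreal (if l \<in> {0..\<Lambda>} then l powr (1 - \<gamma>) else 0)) \<in> borel_measurable lborel"
        "(\<lambda>l. ennreal (if l \<in> {\<Lambda>..} then l powr (- (1 + \<gamma>)) else 0)) \<in> borel_measurable lborel"
        by measurable
      have "(\<integral>\<^sup>+l. ennreal (C * B\<^sup>2) * ennreal (if l \<in> {0..\<Lambda>} then l powr (1 - \<gamma>) else 0)
            + ennreal (C * A\<^sup>2) * ennreal (if l \<in> {\<Lambda>..} then l powr (- (1 + \<gamma>)) else 0) \<partial>lborel)
          = (\<integral>\<^sup>+l. ennreal (C * B\<^sup>2) * ennreal (if l \<in> {0..\<Lambda>} then l powr (1 - \<gamma>) else 0) \<partial>lborel)
            + (\<integral>\<^sup>+l. ennreal (C * A\<^sup>2) * ennreal (if l \<in> {\<Lambda>..} then l powr (- (1 + \<gamma>)) else 0) \<partial>lborel)"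
        by (rule nn_integral_add) measurable
      moreover have "(\<integral>\<^sup>+l. ennreal (C * B\<^sup>2) * ennreal (if l \<in> {0..\<Lambda>} then l powr (1 - \<gamma>) else 0) \<partial>lborel)
          = ennreal (C * B\<^sup>2) * (\<integral>\<^sup>+l. ennreal (if l \<in> {0..\<Lambda>} then l powr (1 - \<gamma>) else 0) \<partial>lborel)"
        by (rule nn_integral_cmult) measurable
      moreover have "(\<integral>\<^sup>+l. ennreal (C * A\<^sup>2) * ennreal (if l \<in> {\<Lambda>..} then l powr (- (1 + \<gamma>)) else 0) \<partial>lborel)
          = ennreal (C * A\<^sup>2) * (\<integral>\<^sup>+l. ennreal (if l \<in> {\<Lambda>..} then l powr (- (1 + \<gamma>)) else 0) \<partial>lborel)"
        by (rule nn_integral_cmult) measurable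
      ultimately show ?thesis
        by (simp only:)
    qed
    also have "\<dots> = ennreal (C * B\<^sup>2) * ennreal (\<Lambda> powr (2 - \<gamma>) / (2 - \<gamma>))
        + ennreal (C * A\<^sup>2) * ennreal (\<Lambda> powr (- \<gamma>) / \<gamma>)"
    proof -
      have "(\<integral>\<^sup>+l. ennreal (if l \<in> {0..\<Lambda>} then l powr (1 - \<gamma>) else 0) \<partial>lborel)
          = ennreal (\<Lambda> powr (2 - \<gamma>) / (2 - \<gamma>))"
        using nn_integral_powr_from_0[of "1 - \<gamma>" \<Lambda>] \<gamma> \<Lambda> by simp
      moreover have "(\<integral>\<^sup>+l. ennreal (if l \<in> {\<Lambda>..} then l powr (- (1 + \<gamma>)) else 0) \<partial>lborel)
          = ennreal (\<Lambda> powr (- \<gamma>) / \<gamma>)"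
        using nn_integral_powr_to_inf[of "- (1 + \<gamma>)" \<Lambda>] \<gamma> \<Lambda> by simp
      ultimately show ?thesis by simp
    qed
    also have "\<dots> = ennreal (C * B\<^sup>2 * (\<Lambda> powr (2 - \<gamma>) / (2 - \<gamma>)) + C * A\<^sup>2 * (\<Lambda> powr (- \<gamma>) / \<gamma>))"
      using C \<gamma> by (simp add: ennreal_mult[symmetric] ennreal_plus[symmetric] del: ennreal_plus)
    also have "C * B\<^sup>2 * (\<Lambda> powr (2 - \<gamma>) / (2 - \<gamma>)) + C * A\<^sup>2 * (\<Lambda> powr (- \<gamma>) / \<gamma>)
        = C * (1 / \<gamma> + 1 / (2 - \<gamma>)) * A powr (2 - \<gamma>) * B powr \<gamma>"
    proof -
      have 1: "B\<^sup>2 * \<Lambda> powr (2 - \<gamma>) = A powr (2 - \<gamma>) * B powr \<gamma>"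
        using AB by (simp add: \<Lambda>_def powr_divide powr_diff)
      have 2: "A\<^sup>2 * \<Lambda> powr (- \<gamma>) = A powr (2 - \<gamma>) * B powr \<gamma>"
        using AB by (simp add: \<Lambda>_def powr_divide powr_diff powr_minus field_simps)
      have "C * B\<^sup>2 * (\<Lambda> powr (2 - \<gamma>) / (2 - \<gamma>)) + C * A\<^sup>2 * (\<Lambda> powr (- \<gamma>) / \<gamma>)
          = C * (B\<^sup>2 * \<Lambda> powr (2 - \<gamma>)) / (2 - \<gamma>) + C * (A\<^sup>2 * \<Lambda> powr (- \<gamma>)) / \<gamma>"
        by simp
      then show ?thesis
        unfolding 1 2 by (simp add: algebra_simps)
    qed
    finally have "(\<integral>\<^sup>+l. ennreal ((cmod (h l))\<^sup>2 * p l) \<partial>lborel)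
        \<le> ennreal (C * (1 / \<gamma> + 1 / (2 - \<gamma>)) * A powr (2 - \<gamma>) * B powr \<gamma>)" .
    \<comment> \<open>For a nonnegative measurable integrand the real integral is read off from the
      extended one, so integrability needs no separate argument.\<close>
    moreover have "(LINT l|lborel. (cmod (h l))\<^sup>2 * p l) = enn2real (\<integral>\<^sup>+l. ennreal ((cmod (h l))\<^sup>2 * p l) \<partial>lborel)"
      using p(1) by (intro integral_eq_nn_integral) auto
    ultimately show ?thesis
      using rhs by (simp add: enn2real_leI)
  qed
qed

text \<open>Every admissible constant dominates each difference quotient, hence so does the infimum,
  which is therefore admissible itself.\<close>

lemma lip_seminorm_bound:
  assumes "\<exists>K. K-lipschitz_on {0..} f" and xy: "x \<ge> 0" "y \<ge> 0"
  shows "cmod (f x - f y) \<le> lip_seminorm f * \<bar>x - y\<bar>"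
proof (cases "x = y")
  case False
  then have d: "\<bar>x - y\<bar> > 0" by simp
  have "cmod (f x - f y) / \<bar>x - y\<bar> \<le> lip_seminorm f"
    unfolding lip_seminorm_def
  proof (rule cInf_greatest)
    fix K assume "K \<in> {K. K-lipschitz_on {0..} f}"
    then have "dist (f x) (f y) \<le> K * dist x y"
      using xy by (auto simp: lipschitz_on_def)
    then show "cmod (f x - f y) / \<bar>x - y\<bar> \<le> K"
      using d by (simp add: dist_norm divide_le_eq)
  qed (use assms(1) in auto)
  then show ?thesis
    using d by (simp add: divide_le_eq)
qed simp

lemma fourier_le_sup_norm:
  assumes "integrable lborel \<psi>"
  shows "cmod (fourier \<psi> w) \<le> sup_norm (fourier \<psi>)"
  unfolding sup_norm_def
proof (rule cSUP_upper)
  show "bdd_above (range (\<lambda>w. cmod (fourier \<psi> w)))"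
  proof (rule bdd_aboveI2)
    fix w
    show "cmod (fourier \<psi> w) \<le> (LINT t|lborel. cmod (\<psi> t))"
      using integral_norm_bound[of lborel "\<lambda>t. exp (- (\<i> * of_real (t * w))) * \<psi> t"]
      by (simp add: fourier_def norm_mult)
  qed
qed simp

lemma fourier_measurable:
  assumes "integrable lborel \<psi>"
  shows "fourier \<psi> \<in> borel_measurable borel"
proof -
  have [measurable]: "\<psi> \<in> borel_measurable borel"
    using assms by simp
  show ?thesis
    unfolding fourier_def by measurable
qed

text \<open>The offset \<open>0\<close> is the time in \<^const>\<open>is_wavelet_transform_at\<close>.\<close>

definition dilated_cnj :: "(real \<Rightarrow> complex) \<Rightarrow> real \<Rightarrow> real \<Rightarrow> complex" where
  "dilated_cnj \<psi> s \<tau> = (if s > 0 then of_real (1 / s) * cnj (\<psi> ((\<tau> - 0) / s)) else 0)"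

lemma dilated_cnj_integrable:
  assumes "integrable lborel \<psi>"
  shows "integrable lborel (dilated_cnj \<psi> s)"
proof (cases "s > 0")
  case True
  have "integrable lborel (\<lambda>\<tau>. \<psi> (0 + (1 / s) * \<tau>))"
    using assms True by (subst lborel_integrable_real_affine_iff) auto
  then have "integrable lborel (\<lambda>\<tau>. of_real (1 / s) * cnj (\<psi> ((1 / s) * \<tau>)))"
    by (intro integrable_mult_right integrable_cnj) simp
  with True show ?thesis
    by (simp add: dilated_cnj_def[abs_def])
qed (simp add: dilated_cnj_def[abs_def])

text \<open>Scale zero fits the formula because \<open>fourier \<psi> 0 = 0\<close>; this is what
  allows \<open>0\<close> to serve as a point of the net.\<close>

lemma dilated_cnj_transform:
  assumes "fourier \<psi> 0 = 0" "s \<ge> 0"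
  shows "(LINT \<tau>|lborel. dilated_cnj \<psi> s \<tau> * exp (\<i> * of_real (\<tau> * l))) = cnj (fourier \<psi> (s * l))"
proof (cases "s > 0")
  case True
  have "(LINT \<tau>|lborel. dilated_cnj \<psi> s \<tau> * exp (\<i> * of_real (\<tau> * l)))
      = \<bar>s\<bar> *\<^sub>R (LINT x|lborel. dilated_cnj \<psi> s (0 + s * x) * exp (\<i> * of_real ((0 + s * x) * l)))"
    using True by (intro lborel_integral_real_affine) simp
  also have "\<dots> = (LINT x|lborel. s *\<^sub>R (dilated_cnj \<psi> s (0 + s * x) * exp (\<i> * of_real ((0 + s * x) * l))))"
    using True by simp
  also have "\<dots> = (LINT x|lborel. cnj (exp (- (\<i> * of_real (x * (s * l)))) * \<psi> x))"
    using True by (intro Bochner_Integration.integral_cong refl)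
      (simp add: dilated_cnj_def scaleR_conv_of_real exp_cnj mult_ac)
  also have "\<dots> = cnj (fourier \<psi> (s * l))"
    unfolding fourier_def by (rule Bochner_Integration.integral_cnj)
  finally show ?thesis .
next
  case False
  with assms show ?thesis
    by (simp add: dilated_cnj_def)
qed

text \<open>For nonnegative scales, analyticity removes all frequencies \<open>l \<le> 0\<close>, so
  Lipschitz continuity on the half-line is enough. The linear bound has slope proportional to
  \<open>\<bar>s - t\<bar>\<close>, whose power \<open>\<gamma>\<close> becomes the increment
  bound.\<close>

lemma (in spectral_process) dilated_increment_le:
  assumes \<psi>: "integrable lborel \<psi>" and analytic: "analytic_wavelet \<psi>"
    and lip: "\<exists>K. K-lipschitz_on {0..} (fourier \<psi>)"
    and p: "\<And>l. p l > 0" "\<And>l. l \<noteq> 0 \<Longrightarrow> p l \<le> C * \<bar>l\<bar> powr (- (1 + \<gamma>))"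
    and \<gamma>: "0 < \<gamma>" "\<gamma> < 2" and C: "C > 0" and st: "s \<ge> 0" "t \<ge> 0"
    and X: "weighted_integral (\<lambda>\<tau>. dilated_cnj \<psi> s \<tau> - dilated_cnj \<psi> t \<tau>) X"
  shows "expectation (\<lambda>\<omega>. (cmod (X \<omega>))\<^sup>2)
    \<le> C * (1 / \<gamma> + 1 / (2 - \<gamma>)) * (2 * sup_norm (fourier \<psi>)) powr (2 - \<gamma>)
        * (lip_seminorm (fourier \<psi>) * \<bar>s - t\<bar>) powr \<gamma>"
proof -
  define h where "h l = fourier \<psi> (s * l) - fourier \<psi> (t * l)" for l
  have an: "fourier \<psi> w = 0" if "w \<le> 0" for w
    using analytic that by (simp add: analytic_wavelet_def)
  have G: "(LINT \<tau>|lborel. (dilated_cnj \<psi> s \<tau> - dilated_cnj \<psi> t \<tau>) * exp (\<i> * of_real (\<tau> * l))) = cnj (h l)" for l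
  proof -
    have int: "integrable lborel (\<lambda>\<tau>. dilated_cnj \<psi> s \<tau> * exp (\<i> * of_real (\<tau> * l)))" for s
    proof (rule Bochner_Integration.integrable_bound[OF dilated_cnj_integrable[OF \<psi>, of s]])
      have [measurable]: "dilated_cnj \<psi> s \<in> borel_measurable borel"
        using dilated_cnj_integrable[OF \<psi>, of s] by simp
      show "(\<lambda>\<tau>. dilated_cnj \<psi> s \<tau> * exp (\<i> * of_real (\<tau> * l))) \<in> borel_measurable lborel"
        by measurable
    qed (simp add: norm_mult)
    have "(LINT \<tau>|lborel. (dilated_cnj \<psi> s \<tau> - dilated_cnj \<psi> t \<tau>) * exp (\<i> * of_real (\<tau> * l)))
        = (LINT \<tau>|lborel. dilated_cnj \<psi> s \<tau> * exp (\<i> * of_real (\<tau> * l)))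
          - (LINT \<tau>|lborel. dilated_cnj \<psi> t \<tau> * exp (\<i> * of_real (\<tau> * l)))"
      unfolding left_diff_distrib by (rule Bochner_Integration.integral_diff[OF int int])
    then show ?thesis
      unfolding dilated_cnj_transform[OF an[OF order_refl] st(1)]
        dilated_cnj_transform[OF an[OF order_refl] st(2)]
      by (simp add: h_def)
  qed
  have [measurable]: "fourier \<psi> \<in> borel_measurable borel"
    by (rule fourier_measurable[OF \<psi>])
  have "expectation (\<lambda>\<omega>. (cmod (X \<omega>))\<^sup>2) = (LINT l|lborel. (cmod (h l))\<^sup>2 * p l)"
    unfolding weighted_integral_isometry[OF X] G complex_mod_cnj ..
  also have "\<dots> \<le> C * (1 / \<gamma> + 1 / (2 - \<gamma>)) * (2 * sup_norm (fourier \<psi>)) powr (2 - \<gamma>)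
        * (lip_seminorm (fourier \<psi>) * \<bar>s - t\<bar>) powr \<gamma>"
  proof (rule integral_cmod_power2_density_le[OF \<gamma> C])
    show "p \<in> borel_measurable borel"
      using borel_measurable_integrable[OF spectral[unfolded has_spectral_density_def, THEN conjunct1]]
      by simp
    show "h \<in> borel_measurable borel"
      unfolding h_def by measurable
    show "p l \<ge> 0" for l
      using p(1)[of l] by simp
    show "h l = 0" if "l \<le> 0" for l
      using that st by (simp add: h_def an mult_nonneg_nonpos)
    show "cmod (h l) \<le> 2 * sup_norm (fourier \<psi>)" for l
      using norm_triangle_ineq4[of "fourier \<psi> (s * l)" "fourier \<psi> (t * l)"]
        fourier_le_sup_norm[OF \<psi>, of "s * l"] fourier_le_sup_norm[OF \<psi>, of "t * l"]
      by (simp add: h_def)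
    show "cmod (h l) \<le> lip_seminorm (fourier \<psi>) * \<bar>s - t\<bar> * l" if "l > 0" for l
    proof -
      have "cmod (h l) \<le> lip_seminorm (fourier \<psi>) * \<bar>s * l - t * l\<bar>"
        unfolding h_def using that st by (intro lip_seminorm_bound lip) auto
      also have "\<bar>s * l - t * l\<bar> = \<bar>s - t\<bar> * l"
        using that by (simp add: left_diff_distrib[symmetric] abs_mult)
      finally show ?thesis by (simp add: mult.assoc)
    qed
  qed (rule p(2))
  finally show ?thesis .
qed

section \<open>Geometric sums and entropy of the net of scales\<close>

lemma sum_geometric_weights_le:
  fixes D :: real
  assumes "D > 1"
  shows "(\<Sum>k\<le>K. D / D ^ k) \<le> D\<^sup>2 / (D - 1)"
    and "(\<Sum>k\<le>K. real (Suc k) * (D / D ^ k)) \<le> D ^ 3 / (D - 1)\<^sup>2"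
proof -
  have x: "norm (1 / D) < 1" "D \<noteq> 0" "1 - 1 / D = (D - 1) / D"
    using assms by (simp_all add: field_simps)
  have "(\<lambda>k. D * (1 / D) ^ k) sums (D * (1 / (1 - 1 / D)))"
    by (intro sums_mult geometric_sums x)
  also have "D * (1 / (1 - 1 / D)) = D\<^sup>2 / (D - 1)"
    unfolding x(3) by (simp add: power2_eq_square)
  finally have sums: "(\<lambda>k. D / D ^ k) sums (D\<^sup>2 / (D - 1))"
    by (simp add: power_divide)
  show "(\<Sum>k\<le>K. D / D ^ k) \<le> D\<^sup>2 / (D - 1)"
    unfolding sums_unique[OF sums] using assms
    by (intro sum_le_suminf sums_summable[OF sums]) auto
  \<comment> \<open>The differentiated geometric series at \<open>1 / D\<close>; the factor
    \<open>Suc k\<close> stems from the linear bound on the square-root entropy of level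
    \<open>k\<close>.\<close>
  have "(\<lambda>k. D * (real (Suc k) * (1 / D) ^ k)) sums (D * (1 / (1 - 1 / D)\<^sup>2))"
    by (intro sums_mult geometric_deriv_sums x)
  also have "D * (1 / (1 - 1 / D)\<^sup>2) = D ^ 3 / (D - 1)\<^sup>2"
    unfolding x(3) by (simp add: power_divide power2_eq_square power3_eq_cube)
  also have "(\<lambda>k. D * (real (Suc k) * (1 / D) ^ k)) = (\<lambda>k. real (Suc k) * (D / D ^ k))"
    by (simp add: power_divide mult.left_commute mult.commute)
  finally have sums: "(\<lambda>k. real (Suc k) * (D / D ^ k)) sums (D ^ 3 / (D - 1)\<^sup>2)" .
  show "(\<Sum>k\<le>K. real (Suc k) * (D / D ^ k)) \<le> D ^ 3 / (D - 1)\<^sup>2"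
    unfolding sums_unique[OF sums] using assms
    by (intro sum_le_suminf sums_summable[OF sums]) auto
qed

text \<open>The argument of the logarithm is 4 times the bound on the size of the net at level
  \<open>k\<close>. Its logarithm splits into a constant, a part linear in \<open>k\<close>, and the
  parts of \<open>C\<close> and \<open>T\<close>; a sum of squares of nonnegative numbers is at most
  the square of their sum, which separates the square root into three terms.\<close>

lemma sqrt_entropy_le:
  fixes D \<gamma> \<beta> C T :: real
  assumes D: "D \<ge> 2" and \<gamma>: "0 < \<gamma>" "\<gamma> < 2" and \<beta>: "0 < \<beta>" "\<beta> \<le> 1" and C: "C \<ge> 1" and T: "T \<ge> 1"
  shows "sqrt (ln (4 * (2 * T * D powr (2 * real k * (1 / \<gamma> + 1 / \<beta>)) * C powr (2 / \<gamma>))))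
    \<le> 2 * (real (Suc k) * (sqrt (ln D) * sqrt (1 / \<gamma> + 1 / \<beta>)) + (sqrt (1 / \<gamma> * ln C) + sqrt (ln T)))"
proof -
  define a where "a = 1 / \<gamma> + 1 / \<beta>"
  define P where "P = ln D * a"
  define x y z where "x = real (Suc k) * sqrt P" and "y = sqrt (1 / \<gamma> * ln C)" and "z = sqrt (ln T)"
  \<comment> \<open>The constant \<open>ln 8 = 3 * ln 2\<close> has to be absorbed: the exponents
    give \<open>a \<ge> 3 / 2\<close>, and \<open>D \<ge> 2\<close> then makes \<open>2 * P\<close>
    large enough.\<close>
  have "1 / \<gamma> \<ge> 1 / 2" "1 / \<beta> \<ge> 1"
    using \<gamma> \<beta> by (simp_all add: divide_simps)
  then have a: "a \<ge> 3 / 2"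
    by (simp add: a_def)
  have "ln 2 \<le> ln D"
    using D by simp
  then have "ln 2 * (3 / 2) \<le> P"
    unfolding P_def using a D by (intro mult_mono) auto
  then have P: "3 * ln 2 \<le> 2 * P"
    by simp
  moreover have "ln (2::real) > 0"
    by simp
  ultimately have P0: "P \<ge> 0"
    by linarith
  have nonneg: "x \<ge> 0" "y \<ge> 0" "z \<ge> 0"
    using P0 \<gamma> C T by (simp_all add: x_def y_def z_def)
  have "ln (4 * (2 * T * D powr (2 * real k * a) * C powr (2 / \<gamma>)))
      = ln 8 + ln T + 2 * real k * P + 2 * (1 / \<gamma> * ln C)"
    using D C T by (simp add: ln_mult ln_powr P_def)
  also have "ln (8::real) = 3 * ln 2"
    using ln_realpow[of "2::real" 3] by simp
  also have "3 * ln 2 + ln T + 2 * real k * P + 2 * (1 / \<gamma> * ln C) \<le> 4 * (x\<^sup>2 + y\<^sup>2 + z\<^sup>2)"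
  proof -
    have sq: "x\<^sup>2 = (real (Suc k))\<^sup>2 * P" "y\<^sup>2 = 1 / \<gamma> * ln C" "z\<^sup>2 = ln T"
      using P0 \<gamma> C T by (simp_all add: x_def y_def z_def power_mult_distrib)
    \<comment> \<open>The \<open>2 * P\<close> that pays for \<open>ln 8\<close> and the part linear
      in \<open>k\<close> fit together under the square of \<open>Suc k\<close>.\<close>
    have "(2 + 2 * real k) * P \<le> (4 * (real (Suc k))\<^sup>2) * P"
      using P0 by (intro mult_right_mono) (simp_all add: power2_eq_square algebra_simps)
    then have "2 * P + 2 * real k * P \<le> 4 * ((real (Suc k))\<^sup>2 * P)"
      by (simp add: algebra_simps)
    moreover have "0 \<le> 1 / \<gamma> * ln C" "0 \<le> ln T"
      using \<gamma> C T by simp_all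
    moreover have "a + t + b + 2 * u \<le> 4 * (q + u + t)"
      if "2 * P + b \<le> 4 * q" "0 \<le> u" "0 \<le> t" "a \<le> 2 * P" for a b q t u :: real
      using that by argo
    ultimately show ?thesis
      unfolding sq using P by blast
  qed
  also have "\<dots> \<le> (2 * (x + (y + z)))\<^sup>2"
    using nonneg by (simp add: power2_eq_square algebra_simps)
  finally have "sqrt (ln (4 * (2 * T * D powr (2 * real k * a) * C powr (2 / \<gamma>)))) \<le> 2 * (x + (y + z))"
    using nonneg by (intro real_le_lsqrt) auto
  then show ?thesis
    by (simp add: x_def y_def z_def P_def a_def real_sqrt_mult)
qed

text \<open>The weights \<open>D / D ^ k\<close> bound the links between the levels \<open>k - 1\<close> and \<open>k\<close>; at the root the
  bound is \<open>D\<close> itself.\<close>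

lemma (in prob_space) expectation_sup_holder_decay_le:
  fixes X :: "real \<Rightarrow> 'a \<Rightarrow> complex" and \<gamma> \<beta> C T D :: real
  assumes meas: "\<And>s. s \<ge> 0 \<Longrightarrow> X s \<in> borel_measurable M" and X0: "X 0 = (\<lambda>_. 0)"
    and mgf: "\<And>s t \<theta> \<sigma>. s \<ge> 0 \<Longrightarrow> t \<ge> 0 \<Longrightarrow> \<theta> \<ge> 0 \<Longrightarrow>
      expectation (\<lambda>\<omega>. (cmod (X s \<omega> - X t \<omega>))\<^sup>2) \<le> \<sigma>\<^sup>2 \<Longrightarrow>
      (\<integral>\<^sup>+\<omega>. ennreal (exp (\<theta> * cmod (X s \<omega> - X t \<omega>))) \<partial>M) \<le> ennreal (4 * exp (\<theta>\<^sup>2 * \<sigma>\<^sup>2))"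
    and holder: "\<And>s t. s \<ge> 0 \<Longrightarrow> t \<ge> 0 \<Longrightarrow>
      expectation (\<lambda>\<omega>. (cmod (X s \<omega> - X t \<omega>))\<^sup>2) \<le> C\<^sup>2 * \<bar>s - t\<bar> powr \<gamma>"
    and decay: "\<And>s. s \<ge> T \<Longrightarrow> expectation (\<lambda>\<omega>. (cmod (X s \<omega>))\<^sup>2) \<le> s powr (- \<beta>)"
    and bound: "\<And>s. s \<ge> 0 \<Longrightarrow> expectation (\<lambda>\<omega>. (cmod (X s \<omega>))\<^sup>2) \<le> D\<^sup>2"
    and \<gamma>: "0 < \<gamma>" "\<gamma> < 2" and \<beta>: "0 < \<beta>" "\<beta> \<le> 1" and C: "C \<ge> 1" and T: "T \<ge> 1" and D: "D \<ge> 2"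
    and F: "finite F" "F \<subseteq> {0..}"
  shows "(\<integral>\<^sup>+\<omega>. (SUP s\<in>F. ennreal (cmod (X s \<omega>))) \<partial>M)
    \<le> ennreal (4 * (sqrt (ln D) * (D ^ 3 / (D - 1)\<^sup>2) * sqrt (1 / \<gamma> + 1 / \<beta>)
        + (sqrt (1 / \<gamma> * ln C) + sqrt (ln T)) * (D\<^sup>2 / (D - 1))))" (is "_ \<le> ennreal ?B")
proof -
  define \<epsilon> where "\<epsilon> k = 1 / D ^ k" for k
  \<comment> \<open>Beyond \<open>R k\<close> the decay applies, as \<open>R k \<ge> T\<close>, and
    \<open>(D powr (2 * real k / \<beta>)) powr (- \<beta>)\<close> is exactly
    \<open>(\<epsilon> k)\<^sup>2\<close>; the factor \<open>T \<ge> 1\<close> only enlarges the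
    radius.\<close>
  define R where "R k = T * D powr (2 * real k / \<beta>)" for k
  \<comment> \<open>The mesh solves
    \<open>C\<^sup>2 * h k powr \<gamma> = (\<epsilon> k)\<^sup>2\<close>, so rounding down to the
    net costs at most \<open>\<epsilon> k\<close>.\<close>
  define h where "h k = (\<epsilon> k / C) powr (2 / \<gamma>)" for k
  \<comment> \<open>This is \<open>2 * (R k / h k)\<close>. The factor 2 pays for the point
    \<open>0\<close> of the net: since \<open>R k / h k \<ge> 1\<close>, the one additional point is
    at most another \<open>R k / h k\<close>.\<close>
  define N where "N k = 2 * T * D powr (2 * real k * (1 / \<gamma> + 1 / \<beta>)) * C powr (2 / \<gamma>)" for k
  define b where "b k = D / D ^ k" for k
  define V where "V k = (\<lambda>j. h k * real j) ` {..nat \<lfloor>R k / h k\<rfloor>}" for k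
  define \<pi> where "\<pi> k s = (if s < R k then h k * real (nat \<lfloor>s / h k\<rfloor>) else 0)" for k s
  have \<epsilon>: "\<epsilon> k > 0" "\<epsilon> k \<le> 1" for k
    using D by (simp_all add: \<epsilon>_def)
  have h: "h k > 0" "h k \<le> 1" for k
  proof -
    show "h k > 0"
      using \<epsilon>[of k] C by (simp add: h_def)
    have "\<epsilon> k / C \<le> 1"
      using \<epsilon>[of k] C by simp
    then show "h k \<le> 1"
      unfolding h_def using \<epsilon>[of k] C \<gamma> by (intro powr_le1) auto
  qed
  have R: "R k \<ge> T" "R k \<ge> 1" for k
  proof -
    have "D powr (2 * real k / \<beta>) \<ge> 1"
      using D \<beta> by (intro ge_one_powr_ge_zero) auto
    then show "R k \<ge> T"
      using T by (simp add: R_def)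
    with T show "R k \<ge> 1"
      by simp
  qed
  have \<epsilon>powr: "\<epsilon> k = D powr (- real k)" for k
    using D by (simp add: \<epsilon>_def powr_minus powr_realpow divide_inverse)
  have Req: "2 * (R k / h k) = N k" for k
  proof -
    have "h k = D powr (- (2 * real k / \<gamma>)) / C powr (2 / \<gamma>)"
      using D C by (simp add: h_def \<epsilon>powr powr_divide powr_powr mult.commute)
    then have "R k / h k = R k * (D powr (2 * real k / \<gamma>) * C powr (2 / \<gamma>))"
      by (simp add: powr_minus divide_inverse)
    moreover have "D powr (2 * real k * (1 / \<gamma> + 1 / \<beta>)) = D powr (2 * real k / \<beta>) * D powr (2 * real k / \<gamma>)"
      by (simp add: powr_add[symmetric] algebra_simps)
    ultimately show ?thesis
      by (simp add: R_def N_def mult_ac)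
  qed
  have card: "real (card (V k)) \<le> N k" and N1: "N k \<ge> 1" for k
  proof -
    have q: "R k / h k \<ge> 1"
      using R[of k] h[of k] by (simp add: divide_simps)
    have "card (V k) \<le> Suc (nat \<lfloor>R k / h k\<rfloor>)"
      unfolding V_def using card_image_le[of "{..nat \<lfloor>R k / h k\<rfloor>}" "\<lambda>j. h k * real j"] by simp
    then have "real (card (V k)) \<le> real (nat \<lfloor>R k / h k\<rfloor>) + 1"
      by linarith
    also have "real (nat \<lfloor>R k / h k\<rfloor>) \<le> R k / h k"
      using q by linarith
    also have "R k / h k + 1 \<le> N k"
      unfolding Req[symmetric] using q by simp
    finally show "real (card (V k)) \<le> N k"
      by simp
    show "N k \<ge> 1"
      unfolding Req[symmetric] using q by simp
  qed
  have \<pi>V: "\<pi> k s \<in> V k" if "s \<ge> 0" for k s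
  proof (cases "s < R k")
    case True
    have "s / h k \<le> R k / h k"
      using True h[of k] by (intro divide_right_mono) auto
    then have "nat \<lfloor>s / h k\<rfloor> \<le> nat \<lfloor>R k / h k\<rfloor>"
      by (intro nat_mono floor_mono)
    then show ?thesis
      using True by (auto simp: \<pi>_def V_def)
  next
    case False
    then show ?thesis
      by (auto simp: \<pi>_def V_def intro!: image_eqI[of _ _ 0])
  qed
  have V0: "V k \<subseteq> {0..}" for k
    using h[of k] by (auto simp: V_def)
  have step: "expectation (\<lambda>\<omega>. (cmod (X s \<omega> - X (\<pi> k s) \<omega>))\<^sup>2) \<le> (\<epsilon> k)\<^sup>2" if s: "s \<ge> 0" for s k
  proof (cases "s < R k")
    case True
    define j where "j = nat \<lfloor>s / h k\<rfloor>"
    have "0 \<le> s / h k"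
      using s h[of k] by simp
    then have "real j \<le> s / h k" "s / h k \<le> real j + 1"
      unfolding j_def by linarith+
    then have "h k * real j \<le> s" "s \<le> h k * real j + h k"
      using h(1)[of k] by (simp_all add: field_simps)
    then have dist: "\<bar>s - \<pi> k s\<bar> \<le> h k"
      using True by (simp add: \<pi>_def j_def[symmetric])
    have "\<pi> k s \<ge> 0"
      using \<pi>V[OF s] V0 by auto
    then have "expectation (\<lambda>\<omega>. (cmod (X s \<omega> - X (\<pi> k s) \<omega>))\<^sup>2) \<le> C\<^sup>2 * \<bar>s - \<pi> k s\<bar> powr \<gamma>"
      using s by (intro holder)
    also have "\<dots> \<le> C\<^sup>2 * h k powr \<gamma>"
      using dist \<gamma> by (intro mult_left_mono powr_mono2) auto
    also have "h k powr \<gamma> = (\<epsilon> k / C)\<^sup>2"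
      using \<epsilon>[of k] C \<gamma> by (simp add: h_def powr_powr)
    also have "C\<^sup>2 * (\<epsilon> k / C)\<^sup>2 = (\<epsilon> k)\<^sup>2"
      using C by (simp add: power_divide)
    finally show ?thesis .
  next
    case False
    have "expectation (\<lambda>\<omega>. (cmod (X s \<omega> - X (\<pi> k s) \<omega>))\<^sup>2) = expectation (\<lambda>\<omega>. (cmod (X s \<omega>))\<^sup>2)"
      using False by (simp add: \<pi>_def X0)
    also have "\<dots> \<le> s powr (- \<beta>)"
      using False R[of k] by (intro decay) simp
    also have "\<dots> \<le> (D powr (2 * real k / \<beta>)) powr (- \<beta>)"
    proof (rule powr_mono2')
      have "D powr (2 * real k / \<beta>) \<le> R k"
        using mult_right_mono[OF T, of "D powr (2 * real k / \<beta>)"] by (simp add: R_def)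
      with False show "D powr (2 * real k / \<beta>) \<le> s"
        by simp
    qed (use \<beta> D in auto)
    also have "\<dots> = (\<epsilon> k)\<^sup>2"
      using \<beta> D by (simp add: \<epsilon>powr powr_powr power2_eq_square powr_add[symmetric])
    finally show ?thesis .
  qed
  have bSuc: "b (Suc k) = \<epsilon> k" for k
    using D by (simp add: b_def \<epsilon>_def)
  \<comment> \<open>The maximum with 1 covers an empty \<open>F\<close>, for which the logarithm
    would be of zero.\<close>
  define n where "n = max 1 (real (card F))"
  have lower: "(\<integral>\<^sup>+\<omega>. (SUP s\<in>F. ennreal (cmod (X s \<omega>))) \<partial>M) \<le> ennreal (?B + 2 * b (Suc K) * sqrt (ln (4 * n)))" for K
  proof -
    have "(\<integral>\<^sup>+\<omega>. (SUP s\<in>F. ennreal (cmod (X s \<omega>))) \<partial>M)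
        \<le> ennreal ((\<Sum>k\<le>K. 2 * b k * sqrt (ln (4 * N k))) + 2 * b (Suc K) * sqrt (ln (4 * n)))"
    proof (rule chaining_bound[where I = "{0..}" and T = V and \<pi> = \<pi>])
      show "(\<integral>\<^sup>+\<omega>. ennreal (exp (\<theta> * cmod (X u \<omega>))) \<partial>M) \<le> ennreal (4 * exp (\<theta>\<^sup>2 * (b 0)\<^sup>2))"
        if "u \<in> {0..}" "\<theta> \<ge> 0" for u \<theta>
        using mgf[of u 0 \<theta> D] bound[of u] that by (simp add: X0 b_def)
      show "(\<integral>\<^sup>+\<omega>. ennreal (exp (\<theta> * cmod (X u \<omega> - X (\<pi> k u) \<omega>))) \<partial>M)
          \<le> ennreal (4 * exp (\<theta>\<^sup>2 * (b (Suc k))\<^sup>2))" if "u \<in> {0..}" "\<theta> \<ge> 0" for u \<theta> k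
        unfolding bSuc using that \<pi>V[of u k] V0[of k] by (intro mgf step) auto
    qed (use meas card N1 \<pi>V V0 F D in \<open>auto simp: V_def n_def b_def\<close>)
    also have "\<dots> \<le> ennreal (?B + 2 * b (Suc K) * sqrt (ln (4 * n)))"
    proof (intro ennreal_leI add_right_mono)
      let ?P = "sqrt (ln D) * sqrt (1 / \<gamma> + 1 / \<beta>)" and ?Q = "sqrt (1 / \<gamma> * ln C) + sqrt (ln T)"
      have PQ: "?P \<ge> 0" "?Q \<ge> 0"
        using D C T \<gamma> \<beta> by simp_all
      have "(\<Sum>k\<le>K. 2 * b k * sqrt (ln (4 * N k))) \<le> (\<Sum>k\<le>K. 2 * b k * (2 * (real (Suc k) * ?P + ?Q)))"
        unfolding N_def using D
        by (intro sum_mono mult_left_mono sqrt_entropy_le D \<gamma> \<beta> C T) (simp add: b_def)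
      also have "\<dots> = 4 * (?P * (\<Sum>k\<le>K. real (Suc k) * b k) + ?Q * (\<Sum>k\<le>K. b k))"
        by (simp only: sum_distrib_left sum.distrib[symmetric]) (simp add: algebra_simps)
      also have "\<dots> \<le> 4 * (?P * (D ^ 3 / (D - 1)\<^sup>2) + ?Q * (D\<^sup>2 / (D - 1)))"
        unfolding b_def using D PQ
        by (intro mult_left_mono add_mono sum_geometric_weights_le) auto
      also have "\<dots> = ?B"
        by (simp only: mult_ac)
      finally show "(\<Sum>k\<le>K. 2 * b k * sqrt (ln (4 * N k))) \<le> ?B" .
    qed
    finally show ?thesis .
  qed
  \<comment> \<open>The size of \<open>F\<close> is fixed while the depth grows, so the cost of the
    last link vanishes and the bound becomes uniform over finite sets.\<close>
  have "(\<lambda>K. 2 * \<epsilon> K * sqrt (ln (4 * n))) \<longlonglongrightarrow> 2 * 0 * sqrt (ln (4 * n))"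
  proof (intro tendsto_intros)
    show "\<epsilon> \<longlonglongrightarrow> 0"
      using D LIMSEQ_power_zero[of "1 / D"] by (simp add: \<epsilon>_def[abs_def] power_divide)
  qed
  then have "(\<lambda>K. ennreal (?B + 2 * b (Suc K) * sqrt (ln (4 * n)))) \<longlonglongrightarrow> ennreal (?B + 2 * 0 * sqrt (ln (4 * n)))"
    unfolding bSuc by (intro tendsto_ennrealI tendsto_add tendsto_const)
  then show ?thesis
    using lower by (intro LIMSEQ_le_const) auto
qed

section \<open>The chaining bound for the wavelet transform with its explicit constants\<close>

theorem lemma3:
  fixes M :: "'w measure" and \<Phi> :: "real \<Rightarrow> 'w \<Rightarrow> real" and p :: "real \<Rightarrow> real"
    and \<psi> :: "real \<Rightarrow> complex" and W :: "real \<Rightarrow> 'w \<Rightarrow> complex"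
    and \<gamma> C\<^sub>1 C\<^sub>2 H Hm T D :: real
  assumes "prob_space M"
    and "gaussian_process M \<Phi>"
    and "stationary_process M \<Phi>"
    and "ms_continuous M \<Phi>"
    and "\<And>l. p l > 0"
    and "has_spectral_density M \<Phi> p"
    and "0 < \<gamma>" and "\<gamma> < 2" and "C\<^sub>1 > 0"
    and "\<And>l. l \<noteq> 0 \<Longrightarrow> p l \<le> C\<^sub>1 * \<bar>l\<bar> powr (- (1 + \<gamma>))"
    and "(long_range_dependent p H \<and> 0 < Hm \<and> Hm < H) \<or> (short_range_dependent p \<and> Hm = 1)"
    and "integrable lborel \<psi>"
    and "integrable lborel (\<lambda>t. (cmod (\<psi> t))\<^sup>2)"
    and "analytic_wavelet \<psi>"
    and "\<exists>K. K-lipschitz_on {0..} (fourier \<psi>)"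
    and "\<And>s. s > 0 \<Longrightarrow> is_wavelet_transform_at M \<psi> \<Phi> 0 s (W s)"
    and "\<And>\<omega>. \<omega> \<in> space M \<Longrightarrow> continuous_on {0<..} (\<lambda>s. W s \<omega>)"
    and "D = max 2 (sqrt (SUP s\<in>{0<..}. (LINT \<omega>|M. (cmod (W s \<omega>))\<^sup>2)))"
    and "C\<^sub>2 = max 1 (sqrt (
           C\<^sub>1 * (1 / \<gamma> + 2 / (2 - \<gamma>)) * (2 * sup_norm (fourier \<psi>)) powr (2 - \<gamma>)
             * lip_seminorm (fourier \<psi>) powr \<gamma>
           + 2 * (sup_norm (fourier \<psi>))\<^sup>2 * prob_space.variance M (\<Phi> 0)))"
    and "T \<ge> 1"
    and "\<And>s. s \<ge> T \<Longrightarrow> (LINT \<omega>|M. (cmod (W s \<omega>))\<^sup>2) \<le> s powr (- Hm)"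
  shows "(\<integral>\<^sup>+\<omega>. (SUP s\<in>{0<..}. ennreal (cmod (W s \<omega>))) \<partial>M)
    \<le> ennreal (4 * (sqrt (ln D) * (D ^ 3 / (D - 1)\<^sup>2) * sqrt (1 / \<gamma> + 1 / Hm)
        + (sqrt (1 / \<gamma> * ln C\<^sub>2) + sqrt (ln T)) * (D\<^sup>2 / (D - 1))))"
proof -
  interpret spectral_process M \<Phi> p
    by (intro spectral_process.intro spectral_process_axioms.intro assms)
  note \<gamma> = assms(7,8) and C1 = assms(9) and \<psi> = assms(12) and analytic = assms(14)
    and lip = assms(15) and T = assms(20) and decay = assms(21)
  define A where "A = (2 * sup_norm (fourier \<psi>)) powr (2 - \<gamma>)"
  define B where "B = lip_seminorm (fourier \<psi>) powr \<gamma>"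
  define K where "K = C\<^sub>1 * (1 / \<gamma> + 2 / (2 - \<gamma>)) * A * B + 2 * (sup_norm (fourier \<psi>))\<^sup>2 * variance (\<Phi> 0)"
  have C2: "C\<^sub>2 = max 1 (sqrt K)"
    using assms(19) by (simp add: K_def A_def B_def)
  have var: "variance (\<Phi> 0) \<ge> 0"
    by (intro integral_nonneg_AE) simp
  have AB: "A \<ge> 0" "B \<ge> 0"
    by (simp_all add: A_def B_def)
  \<comment> \<open>The increment estimate yields the coefficient \<open>1 / (2 - \<gamma>)\<close>;
    the radicand \<open>K\<close> of \<open>C\<^sub>2\<close> dominates it because its remaining
    contributions are nonnegative.\<close>
  have K_ge: "C\<^sub>1 * (1 / \<gamma> + 1 / (2 - \<gamma>)) * A * B \<le> K"
  proof -
    have "C\<^sub>1 * (1 / \<gamma> + 1 / (2 - \<gamma>)) * A * B \<le> C\<^sub>1 * (1 / \<gamma> + 2 / (2 - \<gamma>)) * A * B"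
      using \<gamma> C1 AB by (intro mult_right_mono mult_left_mono add_left_mono divide_right_mono) auto
    also have "\<dots> \<le> K"
      using var by (simp add: K_def)
    finally show ?thesis .
  qed
  have C2_sq: "K \<le> C\<^sub>2\<^sup>2"
    by (rule sqrt_le_D) (simp add: C2)
  define X where "X s = (if s > 0 then W s else (\<lambda>_. 0))" for s
  have an: "fourier \<psi> w = 0" if "w \<le> 0" for w
    using analytic that by (simp add: analytic_wavelet_def)
  have X: "weighted_integral (dilated_cnj \<psi> s) (X s)" for s
  proof (cases "s > 0")
    case True
    have "weighted_integral (dilated_cnj \<psi> s) (W s)"
    proof (rule weighted_integralI)
      show "has_ms_integral M (\<lambda>\<tau> \<omega>. of_real (\<Phi> \<tau> \<omega>) * dilated_cnj \<psi> s \<tau>) (W s)"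
        using assms(16)[OF True] True by (simp add: is_wavelet_transform_at_def dilated_cnj_def)
      show "(LINT \<tau>|lborel. dilated_cnj \<psi> s \<tau>) = 0"
        using dilated_cnj_transform[of \<psi> s 0] an[of 0] True by simp
    qed (rule dilated_cnj_integrable[OF \<psi>])
    with True show ?thesis
      by (simp add: X_def)
  next
    case False
    then have "dilated_cnj \<psi> s = (\<lambda>_. 0)" "X s = (\<lambda>_. 0)"
      by (simp_all add: dilated_cnj_def X_def fun_eq_iff)
    then show ?thesis
      using weighted_integral_zero by simp
  qed
  note Xdiff = weighted_integral_diff[OF X X]
  have holder: "expectation (\<lambda>\<omega>. (cmod (X s \<omega> - X t \<omega>))\<^sup>2) \<le> C\<^sub>2\<^sup>2 * \<bar>s - t\<bar> powr \<gamma>"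
    if "s \<ge> 0" "t \<ge> 0" for s t
  proof -
    have "expectation (\<lambda>\<omega>. (cmod (X s \<omega> - X t \<omega>))\<^sup>2)
        \<le> C\<^sub>1 * (1 / \<gamma> + 1 / (2 - \<gamma>)) * A * (lip_seminorm (fourier \<psi>) * \<bar>s - t\<bar>) powr \<gamma>"
      unfolding A_def
      by (rule dilated_increment_le[OF \<psi> analytic lip assms(5) assms(10) \<gamma> C1 that Xdiff])
    also have "(lip_seminorm (fourier \<psi>) * \<bar>s - t\<bar>) powr \<gamma> = B * \<bar>s - t\<bar> powr \<gamma>"
      unfolding B_def by (rule powr_mult)
    also have "C\<^sub>1 * (1 / \<gamma> + 1 / (2 - \<gamma>)) * A * (B * \<bar>s - t\<bar> powr \<gamma>)
        \<le> C\<^sub>2\<^sup>2 * \<bar>s - t\<bar> powr \<gamma>"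
      unfolding mult.assoc[symmetric] using K_ge C2_sq by (intro mult_right_mono) auto
    finally show ?thesis .
  qed
  have Hm: "0 < Hm" "Hm \<le> 1"
    using assms(11) by (auto simp: long_range_dependent_def)
  \<comment> \<open>A real supremum is an upper bound only for a bounded set. Beyond
    \<open>T\<close> the decay bounds the variance by 1; below \<open>T\<close> the increment from
    scale zero does.\<close>
  have bdd: "bdd_above ((\<lambda>s. expectation (\<lambda>\<omega>. (cmod (W s \<omega>))\<^sup>2)) ` {0<..})"
  proof (rule bdd_aboveI2)
    fix s :: real assume s: "s \<in> {0<..}"
    show "expectation (\<lambda>\<omega>. (cmod (W s \<omega>))\<^sup>2) \<le> C\<^sub>2\<^sup>2 * T powr \<gamma> + 1"
    proof (cases "s \<ge> T")
      case True
      have "expectation (\<lambda>\<omega>. (cmod (W s \<omega>))\<^sup>2) \<le> s powr (- Hm)"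
        by (rule decay[OF True])
      also have "\<dots> \<le> 1 powr (- Hm)"
        using True T Hm by (intro powr_mono2') auto
      also have "\<dots> \<le> C\<^sub>2\<^sup>2 * T powr \<gamma> + 1"
        by simp
      finally show ?thesis .
    next
      case False
      have "expectation (\<lambda>\<omega>. (cmod (W s \<omega>))\<^sup>2) \<le> C\<^sub>2\<^sup>2 * s powr \<gamma>"
        using holder[of s 0] s by (simp add: X_def)
      also have "\<dots> \<le> C\<^sub>2\<^sup>2 * T powr \<gamma>"
        using False s \<gamma> by (intro mult_left_mono powr_mono2) auto
      finally show ?thesis by simp
    qed
  qed
  have D: "D \<ge> 2" "(SUP s\<in>{0<..}. expectation (\<lambda>\<omega>. (cmod (W s \<omega>))\<^sup>2)) \<le> D\<^sup>2"
    by (simp add: assms(18)) (rule sqrt_le_D, simp add: assms(18))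
  show ?thesis
  proof (rule nn_integral_SUP_positive_reals_le)
    show "W s \<in> borel_measurable M" if "s > 0" for s
      using weighted_integralD(4)[OF X[of s]] that by (simp add: X_def square_integrable_measurable)
    show "continuous_on {0<..} (\<lambda>s. W s \<omega>)" if "\<omega> \<in> space M" for \<omega>
      by (rule assms(17)[OF that])
    fix F :: "real set" assume F: "finite F" "F \<subseteq> {0<..}"
    have "(\<integral>\<^sup>+\<omega>. (SUP s\<in>F. ennreal (cmod (W s \<omega>))) \<partial>M) = (\<integral>\<^sup>+\<omega>. (SUP s\<in>F. ennreal (cmod (X s \<omega>))) \<partial>M)"
      using F by (intro nn_integral_cong SUP_cong) (auto simp: X_def)
    also have "\<dots> \<le> ennreal (4 * (sqrt (ln D) * (D ^ 3 / (D - 1)\<^sup>2) * sqrt (1 / \<gamma> + 1 / Hm)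
        + (sqrt (1 / \<gamma> * ln C\<^sub>2) + sqrt (ln T)) * (D\<^sup>2 / (D - 1))))"
    proof (rule expectation_sup_holder_decay_le[OF _ _ _ holder _ _ \<gamma> Hm _ T D(1) F(1)])
      show "X s \<in> borel_measurable M" for s
        by (rule square_integrable_measurable[OF weighted_integralD(4)[OF X]])
      show "X 0 = (\<lambda>_. 0)"
        by (simp add: X_def)
      show "(\<integral>\<^sup>+\<omega>. ennreal (exp (\<theta> * cmod (X s \<omega> - X t \<omega>))) \<partial>M) \<le> ennreal (4 * exp (\<theta>\<^sup>2 * \<sigma>\<^sup>2))"
        if "\<theta> \<ge> 0" "expectation (\<lambda>\<omega>. (cmod (X s \<omega> - X t \<omega>))\<^sup>2) \<le> \<sigma>\<^sup>2" for s t \<theta> \<sigma>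
        by (rule weighted_integral_mgf[OF Xdiff that(2,1)])
      show "expectation (\<lambda>\<omega>. (cmod (X s \<omega>))\<^sup>2) \<le> s powr (- Hm)" if "s \<ge> T" for s
        using decay[OF that] that T by (simp add: X_def)
      show "expectation (\<lambda>\<omega>. (cmod (X s \<omega>))\<^sup>2) \<le> D\<^sup>2" for s
      proof (cases "s > 0")
        case True
        then have "expectation (\<lambda>\<omega>. (cmod (W s \<omega>))\<^sup>2) \<le> (SUP s\<in>{0<..}. expectation (\<lambda>\<omega>. (cmod (W s \<omega>))\<^sup>2))"
          by (intro cSUP_upper bdd) simp
        with D(2) True show ?thesis
          by (simp add: X_def)
      qed (simp add: X_def)
      show "C\<^sub>2 \<ge> 1"
        by (simp add: C2)
      show "F \<subseteq> {0..}"
        using F(2) by auto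
    qed
    finally show "(\<integral>\<^sup>+\<omega>. (SUP s\<in>F. ennreal (cmod (W s \<omega>))) \<partial>M) \<le> \<dots>" .
  qed
qed

end
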